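(* Consider the Hitchin system of infinite rank with structure group $\hat L(\mathrm{GL}(N,\mathbb C))$ over a Riemann curve $\Sigma_n$ with $n$ marked points, and let $H_j$ be one of the Hamiltonians generated by $H(z)=\mathrm{tr}\bigl(P\exp\frac1k\oint_{S^1}\Phi\bigr)$, with time $t_j$ and $\partial_j=\partial/\partial t_j$. After the symplectic reduction by the gauge group, i.e. in terms of the gauge-fixed fields $\bar L=f^{-1}\bar\partial f+f^{-1}\bar Af$ and $$L=kf^{-1}\partial_xf+f^{-1}\Phi f,$$ the equation of motion for the Higgs field takes the form of the Zakharov–Shabat equation $$\partial_jL-k\,\partial_xM_j+[M_j,L]=0,\qquad M_j=f^{-1}\partial_jf.$$
   Context: Upstairs phase space. The fields are $\{(\bar A,\Phi),(\lambda,k),\mathcal O_1,\dots,\mathcal O_n\}$. Here $x\in S^1$ and $z,\bar z$ are local coordinates on $\Sigma_n$; $\bar A=\bar A(x,z,\bar z)$ is a $(0,1)$-form on $\Sigma_n$ with values in the loop algebra $L(\mathrm{gl}(N,\mathbb C))$; $\Phi=\Phi(x,z,\bar z)$ (the Higgs field) is a $(1,0)$-form with values in $L^*(\mathrm{gl}(N,\mathbb C))$ (identified with $\mathrm{gl}(N,\mathbb C)$-valued functions of $x$ via the trace and $\oint dx$); $\lambda$ and $k$ are scalar $(0,1)$- and $(1,0)$-forms on $\Sigma_n$, independent of $x$; $\mathcal O_\alpha$ are coadjoint orbits of $\hat L(\mathrm{GL}(N,\mathbb C))$ at the marked points. The symplectic form is $\omega=\int_{\Sigma_n}\oint\mathrm{tr}(D\Phi\wedge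 D\bar A)\,dx+\int_{\Sigma_n}Dk\wedge D\lambda+\sum_\alpha\omega_\alpha$, with $\omega_\alpha$ the Kirillov–Kostant forms on the orbits. Gauge group. Smooth maps $(f,s)$ from $\Sigma_n$ to $\hat L(\mathrm{GL}(N,\mathbb C))$ (with $f=f(z,\bar z,x)\in\mathrm{GL}(N,\mathbb C)$ and $s$ the central component) act by canonical transformations with $\bar A\mapsto f^{-1}\bar\partial f+f^{-1}\bar Af$, $\Phi\mapsto kf^{-1}\partial_xf+f^{-1}\Phi f$, $k\mapsto k$ (and correspondingly on $\lambda$ and on the orbits). Hamiltonians. $H(z)$ is the trace of the monodromy around $S^1$ of the Higgs field at the point of $\Sigma_n$ with coordinate $z$ ($P\exp$ is the path-ordered exponential); it is gauge invariant, and the $H_j$ are the coefficients of its expansion in a local coordinate $z$. Each $H_j$ is a functional of $\Phi$ and $k$ only. The flow of $H_j$ upstairs is the Hamiltonian flow for $\omega$; in the reduced description, $f=f(z,\bar z,x,t_j)$ is the time-dependent gauge transformation bringing $\bar A$ to the chosen gauge $\bar L$. *)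

theory Defs
  imports "HOL-Complex_Analysis.Complex_Analysis"
begin

section \<open>Smooth functions on open sets\<close>

primrec k_smooth_on ::
    "nat \<Rightarrow> 'a::real_normed_vector set \<Rightarrow> ('a \<Rightarrow> 'b::real_normed_vector) \<Rightarrow> bool" where
  "k_smooth_on 0 S g \<longleftrightarrow> continuous_on S g"
| "k_smooth_on (Suc m) S g \<longleftrightarrow>
     (\<forall>x\<in>S. g differentiable (at x)) \<and>
     (\<forall>v. k_smooth_on m S (\<lambda>x. frechet_derivative g (at x) v))"

definition smooth_on ::
    "'a::real_normed_vector set \<Rightarrow> ('a \<Rightarrow> 'b::real_normed_vector) \<Rightarrow> bool" where
  "smooth_on S g \<longleftrightarrow> (\<forall>m. k_smooth_on m S g)"

section \<open>Matrices and loops\<close>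

definition cscale :: "complex \<Rightarrow> complex^'n^'n \<Rightarrow> complex^'n^'n" where
  "cscale u A = map_matrix (\<lambda>a. u * a) A"

definition comm :: "complex^'n^'n \<Rightarrow> complex^'n^'n \<Rightarrow> complex^'n^'n" where
  "comm A B = A ** B - B ** A"

text \<open>The circle is \<open>\<real> / 2\<pi>\<int>\<close>; functions on it are \<open>2\<pi>\<close>-periodic functions on \<open>\<real>\<close>.\<close>

definition circle_periodic :: "(real \<Rightarrow> 'a) \<Rightarrow> bool" where
  "circle_periodic g \<longleftrightarrow> (\<forall>x. g (x + 2 * pi) = g x)"

definition circle_integral :: "(real \<Rightarrow> complex) \<Rightarrow> complex" where
  "circle_integral g = integral {0..2 * pi} g"

definition dx :: "(real \<Rightarrow> complex^'n^'n) \<Rightarrow> real \<Rightarrow> complex^'n^'n" where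
  "dx g x = vector_derivative g (at x)"

definition smooth_loop :: "(real \<Rightarrow> complex^'n^'n) \<Rightarrow> bool" where
  "smooth_loop g \<longleftrightarrow> smooth_on UNIV g \<and> circle_periodic g"

definition GL_loop :: "(real \<Rightarrow> complex^'n^'n) \<Rightarrow> bool" where
  "GL_loop g \<longleftrightarrow> smooth_loop g \<and> (\<forall>x. invertible (g x))"

text \<open>
  Path-ordered exponential of \<open>B\<close> over \<open>[a, b]\<close>, with later points standing to the right.
  With this ordering the monodromy of \<open>\<Phi>/k\<close> is conjugated under
  \<open>\<Phi> \<mapsto> k f\<inverse> \<partial>\<^sub>x f + f\<inverse> \<Phi> f\<close>, so that its trace is gauge invariant.
\<close>

definition path_ordered_exp :: "(real \<Rightarrow> complex^'n^'n) \<Rightarrow> real \<Rightarrow> real \<Rightarrow> complex^'n^'n" where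
  "path_ordered_exp B a b =
     (THE P. \<exists>\<Psi>. \<Psi> a = mat 1 \<and> \<Psi> b = P \<and>
        (\<forall>x\<in>{a..b}. (\<Psi> has_vector_derivative \<Psi> x ** B x) (at x within {a..b})))"

section \<open>Coadjoint orbits of the centrally extended loop group\<close>

text \<open>
  The smooth dual of the centrally extended loop algebra is identified, via the trace and the
  integral over the circle, with pairs \<open>(p, r)\<close> of a loop and a central charge. The centre acts
  trivially, and the coadjoint action has the same form as the gauge action on \<open>(\<Phi>, k)\<close>.
\<close>

type_synonym 'n loop_dual = "(real \<Rightarrow> complex^'n^'n) \<times> complex"

definition coadjoint_orbit :: "'n::finite loop_dual \<Rightarrow> 'n loop_dual set" where
  "coadjoint_orbit q =
     {(\<lambda>x. cscale (snd q) (matrix_inv (g x) ** dx g x) + matrix_inv (g x) ** fst q x ** g x, snd q)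
        | g. GL_loop g}"

definition is_coadjoint_orbit :: "'n::finite loop_dual set \<Rightarrow> bool" where
  "is_coadjoint_orbit C \<longleftrightarrow> (\<exists>p r. smooth_loop p \<and> C = coadjoint_orbit (p, r))"

definition coadjoint_vector ::
    "'n::finite loop_dual \<Rightarrow> (real \<Rightarrow> complex^'n^'n) \<Rightarrow> 'n loop_dual" where
  "coadjoint_vector q \<xi> = (\<lambda>x. cscale (snd q) (dx \<xi> x) + comm (fst q x) (\<xi> x), 0)"

definition orbit_generator ::
    "'n::finite loop_dual \<Rightarrow> 'n loop_dual \<Rightarrow> (real \<Rightarrow> complex^'n^'n)" where
  "orbit_generator q v = (SOME \<xi>. smooth_loop \<xi> \<and> v = coadjoint_vector q \<xi>)"

text \<open>
  Kirillov--Kostant form: the pairing of \<open>q = (p, r)\<close> with the bracket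
  \<open>([\<xi>, \<eta>], \<integral> tr (\<partial>\<^sub>x\<xi> \<eta>) dx)\<close> of generators of the two tangent vectors. It does not depend
  on the choice of the generators.
\<close>

definition kirillov_kostant ::
    "'n::finite loop_dual \<Rightarrow> 'n loop_dual \<Rightarrow> 'n loop_dual \<Rightarrow> complex" where
  "kirillov_kostant q v w =
     (let \<xi> = orbit_generator q v; \<eta> = orbit_generator q w in
        circle_integral (\<lambda>x. trace (fst q x ** comm (\<xi> x) (\<eta> x)))
        + snd q * circle_integral (\<lambda>x. trace (dx \<xi> x ** \<eta> x)))"

section \<open>Compact Riemann surfaces\<close>

text \<open>A chart is an open set together with a local coordinate on it.\<close>

type_synonym 'p chart = "'p set \<times> ('p \<Rightarrow> complex)"

abbreviation chart_image :: "'p chart \<Rightarrow> complex set" where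
  "chart_image c \<equiv> snd c ` fst c"

abbreviation chart_point :: "'p chart \<Rightarrow> complex \<Rightarrow> 'p" where
  "chart_point c \<equiv> inv_into (fst c) (snd c)"

definition transition :: "'p chart \<Rightarrow> 'p chart \<Rightarrow> complex \<Rightarrow> complex" where
  "transition c d = snd d \<circ> chart_point c"

definition riemann_surface :: "'p::t2_space chart set \<Rightarrow> bool" where
  "riemann_surface \<A> \<longleftrightarrow>
     compact (UNIV :: 'p set) \<and> connected (UNIV :: 'p set) \<and>
     (\<Union>c\<in>\<A>. fst c) = UNIV \<and>
     (\<forall>c\<in>\<A>. open (fst c) \<and> open (chart_image c) \<and>
        homeomorphism (fst c) (chart_image c) (snd c) (chart_point c)) \<and>
     (\<forall>c\<in>\<A>. \<forall>d\<in>\<A>. transition c d holomorphic_on (snd c ` (fst c \<inter> fst d)))"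

text \<open>
  A \<open>(1,1)\<close>-form is given by its coefficients \<open>\<eta> c\<close>, as \<open>\<eta> c(z) dz \<and> dz'\<close>, \<open>z'\<close> the conjugate of \<open>z\<close>, in the
  coordinate \<open>z\<close> of the chart \<open>c\<close>; the factor \<open>-2\<i>\<close> is \<open>dz \<and> dz' = -2\<i> dRe z \<and> dIm z\<close>.
  The integral does not depend on the partition of unity.
\<close>

definition subordinate_partition ::
    "'p::t2_space chart set \<Rightarrow> 'p chart set \<Rightarrow> ('p chart \<Rightarrow> 'p \<Rightarrow> real) \<Rightarrow> bool" where
  "subordinate_partition \<A> D \<rho> \<longleftrightarrow>
     finite D \<and> D \<subseteq> \<A> \<and>
     (\<forall>c\<in>D. continuous_on UNIV (\<rho> c) \<and> (\<forall>p. 0 \<le> \<rho> c p) \<and>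
        closure {p. \<rho> c p \<noteq> 0} \<subseteq> fst c) \<and>
     (\<forall>p. (\<Sum>c\<in>D. \<rho> c p) = 1)"

definition surface_integral ::
    "'p::t2_space chart set \<Rightarrow> ('p chart \<Rightarrow> complex \<Rightarrow> complex) \<Rightarrow> complex" where
  "surface_integral \<A> \<eta> =
     (let (D, \<rho>) = (SOME (D, \<rho>). subordinate_partition \<A> D \<rho>) in
        \<Sum>c\<in>D. - 2 * \<i> * set_lebesgue_integral lborel (chart_image c)
                  (\<lambda>z. complex_of_real (\<rho> c (chart_point c z)) * \<eta> c z))"

definition dbar :: "(complex \<Rightarrow> complex) \<Rightarrow> complex \<Rightarrow> complex" where
  "dbar g z = (frechet_derivative g (at z) 1 + \<i> * frechet_derivative g (at z) \<i>) / 2"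

definition dbar_mat :: "(complex \<Rightarrow> complex^'n^'n) \<Rightarrow> complex \<Rightarrow> complex^'n^'n" where
  "dbar_mat g z = cscale (1/2)
     (frechet_derivative g (at z) 1 + cscale \<i> (frechet_derivative g (at z) \<i>))"

section \<open>Fields\<close>

text \<open>
  Forms are given by their coefficients in the charts, as functions of the local coordinate.
  The marked points are \<open>pts \<alpha>\<close>, \<open>\<alpha> < n\<close>. The \<open>(0,1)\<close>-forms are smooth on the whole surface.
  The \<open>(1,0)\<close>-forms are smooth off the marked points and have at most simple poles there: such
  poles are forced by the moment map equations, whose right-hand sides are delta functions at
  the marked points.
\<close>

type_synonym ('p, 'n) loop_form = "'p chart \<Rightarrow> complex \<Rightarrow> real \<Rightarrow> complex^'n^'n"
type_synonym 'p scalar_form = "'p chart \<Rightarrow> complex \<Rightarrow> complex"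

definition marks :: "nat \<Rightarrow> (nat \<Rightarrow> 'p) \<Rightarrow> 'p set" where
  "marks n pts = pts ` {..<n}"

definition regular_image :: "nat \<Rightarrow> (nat \<Rightarrow> 'p) \<Rightarrow> 'p chart \<Rightarrow> complex set" where
  "regular_image n pts c = snd c ` (fst c - marks n pts)"

definition marks_poly :: "nat \<Rightarrow> (nat \<Rightarrow> 'p) \<Rightarrow> 'p chart \<Rightarrow> complex \<Rightarrow> complex" where
  "marks_poly n pts c z = (\<Prod>p\<in>marks n pts \<inter> fst c. z - snd c p)"

definition loop_form01 ::
    "'p::t2_space chart set \<Rightarrow> ('p, 'n::finite) loop_form \<Rightarrow> bool" where
  "loop_form01 \<A> A \<longleftrightarrow>
     (\<forall>c\<in>\<A>. smooth_on (chart_image c \<times> UNIV) (\<lambda>(z, x). A c z x) \<and>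
        (\<forall>z\<in>chart_image c. circle_periodic (A c z))) \<and>
     (\<forall>c\<in>\<A>. \<forall>d\<in>\<A>. \<forall>z\<in>snd c ` (fst c \<inter> fst d). \<forall>x.
        A c z x = cscale (cnj (deriv (transition c d) z)) (A d (transition c d z) x))"

definition loop_form10 ::
    "'p::t2_space chart set \<Rightarrow> nat \<Rightarrow> (nat \<Rightarrow> 'p) \<Rightarrow> ('p, 'n::finite) loop_form \<Rightarrow> bool" where
  "loop_form10 \<A> n pts \<Phi> \<longleftrightarrow>
     (\<forall>c\<in>\<A>. (\<exists>g. smooth_on (chart_image c \<times> UNIV) g \<and>
          (\<forall>z\<in>regular_image n pts c. \<forall>x. g (z, x) = cscale (marks_poly n pts c z) (\<Phi> c z x))) \<and>
        (\<forall>z\<in>regular_image n pts c. circle_periodic (\<Phi> c z))) \<and>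
     (\<forall>c\<in>\<A>. \<forall>d\<in>\<A>. \<forall>z\<in>snd c ` (fst c \<inter> fst d - marks n pts). \<forall>x.
        \<Phi> c z x = cscale (deriv (transition c d) z) (\<Phi> d (transition c d z) x))"

definition scalar_form01 :: "'p::t2_space chart set \<Rightarrow> 'p scalar_form \<Rightarrow> bool" where
  "scalar_form01 \<A> l \<longleftrightarrow>
     (\<forall>c\<in>\<A>. smooth_on (chart_image c) (l c)) \<and>
     (\<forall>c\<in>\<A>. \<forall>d\<in>\<A>. \<forall>z\<in>snd c ` (fst c \<inter> fst d).
        l c z = cnj (deriv (transition c d) z) * l d (transition c d z))"

definition scalar_form10 ::
    "'p::t2_space chart set \<Rightarrow> nat \<Rightarrow> (nat \<Rightarrow> 'p) \<Rightarrow> 'p scalar_form \<Rightarrow> bool" where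
  "scalar_form10 \<A> n pts k \<longleftrightarrow>
     (\<forall>c\<in>\<A>. \<exists>g. smooth_on (chart_image c) g \<and>
        (\<forall>z\<in>regular_image n pts c. g z = marks_poly n pts c z * k c z)) \<and>
     (\<forall>c\<in>\<A>. \<forall>d\<in>\<A>. \<forall>z\<in>snd c ` (fst c \<inter> fst d - marks n pts).
        k c z = deriv (transition c d) z * k d (transition c d z))"

record ('p, 'n::finite) hitchin_fields =
  Abar :: "('p, 'n) loop_form"
  Higgs :: "('p, 'n) loop_form"
  lam :: "'p scalar_form"
  kay :: "'p scalar_form"
  orb :: "nat \<Rightarrow> 'n loop_dual"

definition phase_space ::
    "'p::t2_space chart set \<Rightarrow> nat \<Rightarrow> (nat \<Rightarrow> 'p) \<Rightarrow> (nat \<Rightarrow> 'n::finite loop_dual set)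
      \<Rightarrow> ('p, 'n) hitchin_fields set" where
  "phase_space \<A> n pts \<O> =
     {X. loop_form01 \<A> (Abar X) \<and> loop_form10 \<A> n pts (Higgs X) \<and>
         scalar_form01 \<A> (lam X) \<and> scalar_form10 \<A> n pts (kay X) \<and>
         (\<forall>\<alpha><n. orb X \<alpha> \<in> \<O> \<alpha>)}"

text \<open>Tangent vectors are recorded by the variations of the fields.\<close>

definition tangent_space ::
    "'p::t2_space chart set \<Rightarrow> nat \<Rightarrow> (nat \<Rightarrow> 'p) \<Rightarrow> ('p, 'n::finite) hitchin_fields
      \<Rightarrow> ('p, 'n) hitchin_fields set" where
  "tangent_space \<A> n pts X =
     {V. loop_form01 \<A> (Abar V) \<and> loop_form10 \<A> n pts (Higgs V) \<and>
         scalar_form01 \<A> (lam V) \<and> scalar_form10 \<A> n pts (kay V) \<and>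
         (\<forall>\<alpha><n. \<exists>\<xi>. smooth_loop \<xi> \<and> orb V \<alpha> = coadjoint_vector (orb X \<alpha>) \<xi>)}"

definition symplectic_form ::
    "'p::t2_space chart set \<Rightarrow> nat \<Rightarrow> ('p, 'n::finite) hitchin_fields
      \<Rightarrow> ('p, 'n) hitchin_fields \<Rightarrow> ('p, 'n) hitchin_fields \<Rightarrow> complex" where
  "symplectic_form \<A> n X V W =
     surface_integral \<A> (\<lambda>c z. circle_integral (\<lambda>x.
        trace (Higgs V c z x ** Abar W c z x) - trace (Higgs W c z x ** Abar V c z x)))
     + surface_integral \<A> (\<lambda>c z. kay V c z * lam W c z - kay W c z * lam V c z)
     + (\<Sum>\<alpha><n. kirillov_kostant (orb X \<alpha>) (orb V \<alpha>) (orb W \<alpha>))"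

section \<open>Gauge group and moment map\<close>

text \<open>The gauge transforms, by \<open>f\<close>, of the gauge field and of the Higgs field.\<close>

definition gauge_Abar ::
    "('p \<Rightarrow> real \<Rightarrow> complex^'n^'n) \<Rightarrow> ('p, 'n::finite) loop_form \<Rightarrow> ('p, 'n) loop_form" where
  "gauge_Abar f A = (\<lambda>c z x.
     matrix_inv (f (chart_point c z) x) ** dbar_mat (\<lambda>w. f (chart_point c w) x) z
     + matrix_inv (f (chart_point c z) x) ** A c z x ** f (chart_point c z) x)"

definition gauge_Higgs ::
    "('p \<Rightarrow> real \<Rightarrow> complex^'n^'n) \<Rightarrow> 'p scalar_form \<Rightarrow> ('p, 'n::finite) loop_form
      \<Rightarrow> ('p, 'n) loop_form" where
  "gauge_Higgs f k \<Phi> = (\<lambda>c z x.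
     cscale (k c z) (matrix_inv (f (chart_point c z) x) ** dx (f (chart_point c z)) x)
     + matrix_inv (f (chart_point c z) x) ** \<Phi> c z x ** f (chart_point c z) x)"

text \<open>Smooth families, parametrized by time, of maps from the surface to the loop group.\<close>

definition gauge_family ::
    "'p::t2_space chart set \<Rightarrow> real set \<Rightarrow> (real \<Rightarrow> 'p \<Rightarrow> real \<Rightarrow> complex^'n::finite^'n) \<Rightarrow> bool" where
  "gauge_family \<A> T f \<longleftrightarrow>
     (\<forall>c\<in>\<A>. smooth_on (T \<times> chart_image c \<times> UNIV) (\<lambda>(t, z, x). f t (chart_point c z) x)) \<and>
     (\<forall>t\<in>T. \<forall>p. circle_periodic (f t p) \<and> (\<forall>x. invertible (f t p x)))"

text \<open>
  With \<open>\<partial>\<^sub>z'\<close> the antiholomorphic derivative, \<open>(\<epsilon>, s)\<close> in the gauge algebra acts by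
  \<open>\<delta>\<Phi> = k \<partial>\<^sub>x\<epsilon> + [\<Phi>, \<epsilon>]\<close>, \<open>\<delta>A = \<partial>\<^sub>z' \<epsilon> + [A, \<epsilon>]\<close>, \<open>\<delta>k = 0\<close>,
  \<open>\<delta>\<lambda> = \<partial>\<^sub>z' s - \<integral> tr (\<partial>\<^sub>x\<epsilon> A) dx\<close>, \<open>\<delta>p = r \<partial>\<^sub>x\<epsilon> + [p, \<epsilon>]\<close>, which is, up to sign, the Hamiltonian vector field of
  the moment map below. In strong form its vanishing reads
  \<open>\<partial>\<^sub>z' \<Phi> - k \<partial>\<^sub>xA + [A, \<Phi>] = \<Sigma> p\<^sub>\<alpha> \<delta>(x\<^sub>\<alpha>)\<close> and \<open>\<partial>\<^sub>z' k = \<Sigma> r\<^sub>\<alpha> \<delta>(x\<^sub>\<alpha>)\<close>.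
\<close>

definition gauge_algebra ::
    "'p::t2_space chart set \<Rightarrow> (('p \<Rightarrow> real \<Rightarrow> complex^'n::finite^'n) \<times> ('p \<Rightarrow> complex)) set" where
  "gauge_algebra \<A> =
     {(\<epsilon>, s). (\<forall>c\<in>\<A>. smooth_on (chart_image c \<times> UNIV) (\<lambda>(z, x). \<epsilon> (chart_point c z) x) \<and>
                    smooth_on (chart_image c) (\<lambda>z. s (chart_point c z))) \<and>
              (\<forall>p. circle_periodic (\<epsilon> p))}"

definition moment_map ::
    "'p::t2_space chart set \<Rightarrow> nat \<Rightarrow> (nat \<Rightarrow> 'p) \<Rightarrow> ('p, 'n::finite) hitchin_fields
      \<Rightarrow> ('p \<Rightarrow> real \<Rightarrow> complex^'n^'n) \<times> ('p \<Rightarrow> complex) \<Rightarrow> complex" where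
  "moment_map \<A> n pts X = (\<lambda>(\<epsilon>, s).
     surface_integral \<A> (\<lambda>c z. circle_integral (\<lambda>x.
        kay X c z * trace (dx (\<epsilon> (chart_point c z)) x ** Abar X c z x)
        + trace (comm (Higgs X c z x) (\<epsilon> (chart_point c z) x) ** Abar X c z x)
        - trace (Higgs X c z x ** dbar_mat (\<lambda>w. \<epsilon> (chart_point c w) x) z)))
     - surface_integral \<A> (\<lambda>c z. kay X c z * dbar (\<lambda>w. s (chart_point c w)) z)
     - (\<Sum>\<alpha><n. circle_integral (\<lambda>x. trace (fst (orb X \<alpha>) x ** \<epsilon> (pts \<alpha>) x))
               + snd (orb X \<alpha>) * s (pts \<alpha>)))"

definition zero_momentum ::
    "'p::t2_space chart set \<Rightarrow> nat \<Rightarrow> (nat \<Rightarrow> 'p) \<Rightarrow> ('p, 'n::finite) hitchin_fields set" where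
  "zero_momentum \<A> n pts = {X. \<forall>e\<in>gauge_algebra \<A>. moment_map \<A> n pts X e = 0}"

section \<open>Hamiltonian flows\<close>

definition vary ::
    "('p, 'n::finite) hitchin_fields \<Rightarrow> ('p, 'n) hitchin_fields \<Rightarrow> real \<Rightarrow> ('p, 'n) hitchin_fields" where
  "vary X V \<epsilon> =
     \<lparr>Abar = (\<lambda>c z x. Abar X c z x + \<epsilon> *\<^sub>R Abar V c z x),
      Higgs = (\<lambda>c z x. Higgs X c z x + \<epsilon> *\<^sub>R Higgs V c z x),
      lam = (\<lambda>c z. lam X c z + \<epsilon> *\<^sub>R lam V c z),
      kay = (\<lambda>c z. kay X c z + \<epsilon> *\<^sub>R kay V c z),
      orb = (\<lambda>\<alpha>. (\<lambda>x. fst (orb X \<alpha>) x + \<epsilon> *\<^sub>R fst (orb V \<alpha>) x,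
                  snd (orb X \<alpha>) + \<epsilon> *\<^sub>R snd (orb V \<alpha>)))\<rparr>"

definition velocity ::
    "(real \<Rightarrow> ('p, 'n::finite) hitchin_fields) \<Rightarrow> real \<Rightarrow> ('p, 'n) hitchin_fields" where
  "velocity X t =
     \<lparr>Abar = (\<lambda>c z x. vector_derivative (\<lambda>\<tau>. Abar (X \<tau>) c z x) (at t)),
      Higgs = (\<lambda>c z x. vector_derivative (\<lambda>\<tau>. Higgs (X \<tau>) c z x) (at t)),
      lam = (\<lambda>c z. vector_derivative (\<lambda>\<tau>. lam (X \<tau>) c z) (at t)),
      kay = (\<lambda>c z. vector_derivative (\<lambda>\<tau>. kay (X \<tau>) c z) (at t)),
      orb = (\<lambda>\<alpha>. (\<lambda>x. vector_derivative (\<lambda>\<tau>. fst (orb (X \<tau>) \<alpha>) x) (at t),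
                  vector_derivative (\<lambda>\<tau>. snd (orb (X \<tau>) \<alpha>)) (at t)))\<rparr>"

definition smooth_trajectory ::
    "'p::t2_space chart set \<Rightarrow> nat \<Rightarrow> (nat \<Rightarrow> 'p) \<Rightarrow> real set
      \<Rightarrow> (real \<Rightarrow> ('p, 'n::finite) hitchin_fields) \<Rightarrow> bool" where
  "smooth_trajectory \<A> n pts T X \<longleftrightarrow>
     (\<forall>c\<in>\<A>.
        smooth_on (T \<times> chart_image c \<times> UNIV) (\<lambda>(t, z, x). Abar (X t) c z x) \<and>
        (\<exists>g. smooth_on (T \<times> chart_image c \<times> UNIV) g \<and>
           (\<forall>t\<in>T. \<forall>z\<in>regular_image n pts c. \<forall>x.
              g (t, z, x) = cscale (marks_poly n pts c z) (Higgs (X t) c z x))) \<and>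
        smooth_on (T \<times> chart_image c) (\<lambda>(t, z). lam (X t) c z) \<and>
        (\<exists>g. smooth_on (T \<times> chart_image c) g \<and>
           (\<forall>t\<in>T. \<forall>z\<in>regular_image n pts c.
              g (t, z) = marks_poly n pts c z * kay (X t) c z))) \<and>
     (\<forall>\<alpha><n. smooth_on (T \<times> UNIV) (\<lambda>(t, x). fst (orb (X t) \<alpha>) x) \<and>
             smooth_on T (\<lambda>t. snd (orb (X t) \<alpha>)))"

text \<open>
  The sign is that of Hamilton's equations for \<open>D\<Phi> \<and> DA\<close>, that is
  \<open>\<partial>\<^sub>t A = \<delta>H/\<delta>\<Phi>\<close> and \<open>\<partial>\<^sub>t \<Phi> = - \<delta>H/\<delta>A\<close>.
\<close>

definition hamiltonian_trajectory ::
    "'p::t2_space chart set \<Rightarrow> nat \<Rightarrow> (nat \<Rightarrow> 'p) \<Rightarrow> (nat \<Rightarrow> 'n::finite loop_dual set)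
      \<Rightarrow> (('p, 'n) hitchin_fields \<Rightarrow> complex) \<Rightarrow> real set
      \<Rightarrow> (real \<Rightarrow> ('p, 'n) hitchin_fields) \<Rightarrow> bool" where
  "hamiltonian_trajectory \<A> n pts \<O> H T X \<longleftrightarrow>
     smooth_trajectory \<A> n pts T X \<and>
     (\<forall>t\<in>T. X t \<in> phase_space \<A> n pts \<O> \<and>
        velocity X t \<in> tangent_space \<A> n pts (X t) \<and>
        (\<forall>W\<in>tangent_space \<A> n pts (X t).
           ((\<lambda>\<epsilon>. H (vary (X t) W \<epsilon>)) has_vector_derivative
              - symplectic_form \<A> n (X t) (velocity X t) W) (at 0)))"

section \<open>The Hamiltonians\<close>

text \<open>\<open>H(z)\<close> in the local coordinate of the chart \<open>c\<close>; it is used only where \<open>k\<close> does not vanish.\<close>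

definition monodromy_trace ::
    "('p, 'n::finite) hitchin_fields \<Rightarrow> 'p chart \<Rightarrow> complex \<Rightarrow> complex" where
  "monodromy_trace X c z =
     trace (path_ordered_exp (\<lambda>x. cscale (1 / kay X c z) (Higgs X c z x)) 0 (2 * pi))"

text \<open>
  Off the zero level of the moment map, \<open>H(z)\<close> is smooth but in general not holomorphic in \<open>z\<close>, so
  that its power series coefficients are not defined there without a further choice.
  A coefficient functional on the disc (or punctured disc) \<open>D\<close> is a linear functional of the
  restriction to \<open>D\<close> that yields the coefficient of \<open>(z - a) powi j\<close> for every holomorphic function.
  Examples are the contour integral of \<open>h(w) / (w - a) powi (j + 1)\<close> over one fixed circle, smooth
  averages of these over the radius, and, if \<open>D\<close> contains \<open>a\<close>, the Taylor functionals \<open>\<partial>\<^sub>z\<^sup>j / j!\<close> at \<open>a\<close>.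
\<close>

definition coefficient_functional ::
    "complex \<Rightarrow> real \<Rightarrow> complex set \<Rightarrow> int \<Rightarrow> ((complex \<Rightarrow> complex) \<Rightarrow> complex) \<Rightarrow> bool" where
  "coefficient_functional a \<rho> D j l \<longleftrightarrow>
     (\<forall>h1 h2 u v. smooth_on D h1 \<and> smooth_on D h2 \<longrightarrow>
        l (\<lambda>z. u * h1 z + v * h2 z) = u * l h1 + v * l h2) \<and>
     (\<forall>h1 h2. (\<forall>z\<in>D. h1 z = h2 z) \<longrightarrow> l h1 = l h2) \<and>
     (\<forall>h r. h holomorphic_on D \<and> 0 < r \<and> r < \<rho> \<longrightarrow>
        l h = contour_integral (circlepath a r) (\<lambda>w. h w / (w - a) powi (j + 1)) / (2 * pi * \<i>))"

definition hitchin_hamiltonian ::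
    "'p chart \<Rightarrow> ((complex \<Rightarrow> complex) \<Rightarrow> complex) \<Rightarrow> ('p, 'n::finite) hitchin_fields \<Rightarrow> complex" where
  "hitchin_hamiltonian c l X = l (monodromy_trace X c)"

end

theory Submission
  imports Defs
begin

text \<open>
  The Hamiltonian depends on \<open>\<Phi>\<close> and \<open>k\<close> only, so its derivative along variations of the conjugate
  fields \<open>A\<close> and \<open>\<lambda>\<close> vanishes: the velocities of \<open>\<Phi>\<close> and \<open>k\<close> pair to zero with all smooth
  \<open>(0,1)\<close>-forms. The conjugate transpose of a \<open>(1,0)\<close>-form is a \<open>(0,1)\<close>-form. Pairing the velocity
  \<open>V\<close> with \<open>\<phi>\<^sup>2\<close> times its conjugate transpose, where the cutoff \<open>\<phi>\<close> vanishes near the marked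
  points, gives up to a constant the integral of \<open>\<phi>\<^sup>2 \<bar>V\<bar>\<^sup>2\<close> against each weight of the partition of unity.
  No cancellation between charts is possible, so \<open>V\<close> vanishes off the marked points. With \<open>\<Phi>\<close> and
  \<open>k\<close> constant in time, the equation for \<open>L\<close> is the product rule together with the equality of the
  mixed partial derivatives of \<open>f\<close> in time and \<open>x\<close>.
\<close>

section \<open>Smooth functions\<close>

text \<open>The test forms have to be smooth across the marked points, while forms of type (1,0) may
  have poles there and, as total functions, take arbitrary values there. Hence the cutoff, and hence
  a conclusion off the marked points: each other point has a cutoff that is nonzero at it. One
  factor \<phi> makes \<phi>V smooth, the second makes the pairing of V with the test form the
  square of the norm of \<phi>V. The surface integral takes its partition of unity by choice, so a
  partition has to be exhibited before a vanishing integral says anything. Likewise a Bochner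
  integral is 0 for a non-integrable function, so integrability has to be drawn from the compact
  supports of the weights. The field \<open>k\<close> has to be constant in time as well:
  \<open>L\<close> contains it, and its derivative would contribute a term of its own.\<close>

lemma k_smooth_on_Suc_frechet:
  "k_smooth_on (Suc m) S g \<Longrightarrow> k_smooth_on m S (\<lambda>x. frechet_derivative g (at x) v)"
  by simp

lemma k_smooth_on_continuous: "k_smooth_on m S g \<Longrightarrow> continuous_on S g"
  by (cases m) (simp_all add: differentiable_imp_continuous_on differentiable_at_imp_differentiable_on)

lemma k_smooth_on_mono: "k_smooth_on (Suc m) S g \<Longrightarrow> k_smooth_on m S g"
proof (induction m arbitrary: g)
  case 0
  then show ?case using k_smooth_on_continuous by fastforce
qed auto

text \<open>On an open set equal values force equal derivatives, so the induction can pass to the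
  derivatives; for this \<open>g\<close> and \<open>h\<close> stay arbitrary.\<close>

lemma k_smooth_on_cong:
  assumes "open S" "\<And>x. x \<in> S \<Longrightarrow> g x = h x"
  shows "k_smooth_on m S g \<longleftrightarrow> k_smooth_on m S h"
  using assms(2)
proof (induction m arbitrary: g h)
  case 0
  then show ?case by (auto intro: continuous_on_cong)
next
  case (Suc m)
  have d: "(g has_derivative D) (at x) \<longleftrightarrow> (h has_derivative D) (at x)" if "x \<in> S" for x D
    using that \<open>open S\<close> Suc.prems has_derivative_transform_within_open
    by (metis (no_types, lifting))
  have f: "frechet_derivative g (at x) = frechet_derivative h (at x)" if "x \<in> S" for x
    unfolding frechet_derivative_def using d[OF that] by simp
  have "g differentiable (at x) \<longleftrightarrow> h differentiable (at x)" if "x \<in> S" for x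
    using d[OF that] by (simp add: differentiable_def)
  moreover have "k_smooth_on m S (\<lambda>x. frechet_derivative g (at x) v) \<longleftrightarrow>
      k_smooth_on m S (\<lambda>x. frechet_derivative h (at x) v)" for v
    by (rule Suc.IH) (simp add: f)
  ultimately show ?case by simp
qed

lemma smooth_on_cong:
  assumes "open S" "\<And>x. x \<in> S \<Longrightarrow> g x = h x"
  shows "smooth_on S g \<longleftrightarrow> smooth_on S h"
  using k_smooth_on_cong[OF assms] by (simp add: smooth_on_def)

lemma smooth_on_continuous: "smooth_on S g \<Longrightarrow> continuous_on S g"
  by (auto simp: smooth_on_def dest: spec[of _ 0])

lemma smooth_on_differentiable: "smooth_on S g \<Longrightarrow> x \<in> S \<Longrightarrow> g differentiable (at x)"
  unfolding smooth_on_def using k_smooth_on.simps(2) by blast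

lemma smooth_on_frechet: "smooth_on S g \<Longrightarrow> smooth_on S (\<lambda>x. frechet_derivative g (at x) v)"
  unfolding smooth_on_def using k_smooth_on.simps(2) by blast

lemma k_smooth_on_subset: "k_smooth_on m S g \<Longrightarrow> R \<subseteq> S \<Longrightarrow> k_smooth_on m R g"
  by (induction m arbitrary: g) (auto intro: continuous_on_subset)

lemma smooth_on_subset: "smooth_on S g \<Longrightarrow> R \<subseteq> S \<Longrightarrow> smooth_on R g"
  using k_smooth_on_subset unfolding smooth_on_def by blast

text \<open>Derivatives at a point do not refer to the set, so only the continuity at order 0 has to
  be glued, and that is where openness enters.\<close>

lemma smooth_on_Un:
  assumes "smooth_on S g" "smooth_on R g" "open S" "open R"
  shows "smooth_on (S \<union> R) g"
proof -
  have "k_smooth_on m (S \<union> R) g" if "k_smooth_on m S g" "k_smooth_on m R g" for m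
    using that
    by (induction m arbitrary: g) (auto intro: continuous_on_open_Un assms)
  then show ?thesis using assms by (simp add: smooth_on_def)
qed

lemma frechet_derivative_eqI:
  "(g has_derivative D) (at x) \<Longrightarrow> frechet_derivative g (at x) = D"
  using frechet_derivative_at by metis

text \<open>This lets the inductions on the order name the derivative by a formula \<open>D\<close>
  instead of handling the chosen \<open>frechet_derivative\<close>.\<close>

lemma k_smooth_on_SucI:
  assumes "open S" "\<And>x. x \<in> S \<Longrightarrow> (g has_derivative D x) (at x)"
    "\<And>v. k_smooth_on m S (\<lambda>x. D x v)"
  shows "k_smooth_on (Suc m) S g"
proof -
  have "k_smooth_on m S (\<lambda>x. frechet_derivative g (at x) v)" for v
    using k_smooth_on_cong[OF assms(1), of "\<lambda>x. frechet_derivative g (at x) v" "\<lambda>x. D x v" m]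
      frechet_derivative_eqI[OF assms(2)] assms(3) by simp
  then show ?thesis using assms(2) by (auto simp: differentiable_def)
qed

lemma k_smooth_on_has_derivative:
  "k_smooth_on (Suc m) S g \<Longrightarrow> x \<in> S \<Longrightarrow> (g has_derivative frechet_derivative g (at x)) (at x)"
  by (simp add: frechet_derivative_works)

lemma smooth_on_has_derivative:
  "smooth_on S g \<Longrightarrow> x \<in> S \<Longrightarrow> (g has_derivative frechet_derivative g (at x)) (at x)"
  using smooth_on_differentiable frechet_derivative_works by blast

section \<open>Constructions that preserve smoothness\<close>

lemma smooth_on_const: "open S \<Longrightarrow> smooth_on S (\<lambda>_. c)"
proof -
  assume "open S"
  have "k_smooth_on m S (\<lambda>_. c)" for m
  proof (induction m arbitrary: c)
    case (Suc m)
    show ?case by (rule k_smooth_on_SucI[OF \<open>open S\<close>, where D = "\<lambda>_ _. 0"]) (auto simp: Suc)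
  qed simp
  then show ?thesis by (simp add: smooth_on_def)
qed

lemma smooth_on_bounded_linear:
  assumes "bounded_linear l" "open S" "smooth_on S g"
  shows "smooth_on S (\<lambda>x. l (g x))"
proof -
  interpret bounded_linear l by fact
  have "k_smooth_on m S g \<Longrightarrow> k_smooth_on m S (\<lambda>x. l (g x))" for m
  proof (induction m arbitrary: g)
    case 0
    then show ?case by (auto intro: continuous_on)
  next
    case (Suc m)
    show ?case
      by (rule k_smooth_on_SucI[OF \<open>open S\<close>, where D = "\<lambda>x v. l (frechet_derivative g (at x) v)"])
        (use Suc k_smooth_on_has_derivative[OF Suc.prems] in \<open>auto intro: has_derivative\<close>)
  qed
  then show ?thesis using assms by (simp add: smooth_on_def)
qed

lemma k_smooth_on_add:
  assumes "open S" "k_smooth_on m S g" "k_smooth_on m S h"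
  shows "k_smooth_on m S (\<lambda>x. g x + h x)"
  using assms(2,3)
proof (induction m arbitrary: g h)
  case 0
  then show ?case by (auto intro: continuous_intros)
next
  case (Suc m)
  show ?case
    by (rule k_smooth_on_SucI[OF \<open>open S\<close>,
        where D = "\<lambda>x v. frechet_derivative g (at x) v + frechet_derivative h (at x) v"])
      (use Suc k_smooth_on_has_derivative[OF Suc.prems(1)] k_smooth_on_has_derivative[OF Suc.prems(2)]
        in \<open>auto intro: has_derivative_add\<close>)
qed

lemma smooth_on_add:
  "open S \<Longrightarrow> smooth_on S g \<Longrightarrow> smooth_on S h \<Longrightarrow> smooth_on S (\<lambda>x. g x + h x)"
  by (simp add: smooth_on_def k_smooth_on_add)

text \<open>By the Leibniz rule the derivative is a sum of two values of \<open>b\<close>. The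
  undifferentiated factors are brought down to order \<open>m\<close> by
  \<open>k_smooth_on_mono\<close>, which closes the induction.\<close>

lemma k_smooth_on_bilinear:
  assumes "bounded_bilinear b" "open S" "k_smooth_on m S g" "k_smooth_on m S h"
  shows "k_smooth_on m S (\<lambda>x. b (g x) (h x))"
proof -
  interpret bounded_bilinear b by fact
  show ?thesis
    using assms(3,4)
  proof (induction m arbitrary: g h)
    case 0
    then show ?case by (auto intro: continuous_on)
  next
    case (Suc m)
    show ?case
      by (rule k_smooth_on_SucI[OF \<open>open S\<close>, where
            D = "\<lambda>x v. b (g x) (frechet_derivative h (at x) v) + b (frechet_derivative g (at x) v) (h x)"])
        (use Suc k_smooth_on_has_derivative[OF Suc.prems(1)] k_smooth_on_has_derivative[OF Suc.prems(2)]
           k_smooth_on_mono[OF Suc.prems(1)] k_smooth_on_mono[OF Suc.prems(2)]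
          in \<open>auto intro!: FDERIV k_smooth_on_add[OF \<open>open S\<close>]\<close>)
  qed
qed

lemma smooth_on_bilinear:
  "bounded_bilinear b \<Longrightarrow> open S \<Longrightarrow> smooth_on S g \<Longrightarrow> smooth_on S h \<Longrightarrow>
    smooth_on S (\<lambda>x. b (g x) (h x))"
  by (simp add: smooth_on_def k_smooth_on_bilinear)

text \<open>The inner map has the constant derivative \<open>l\<close>, so a directional derivative
  of the composite is a composite of the same shape. This covers projections, which add a dummy
  variable, and inclusions, which freeze one.\<close>

lemma smooth_on_compose_affine:
  assumes "bounded_linear l" "open S" "open R" "smooth_on S g" "\<And>x. x \<in> R \<Longrightarrow> a + l x \<in> S"
  shows "smooth_on R (\<lambda>x. g (a + l x))"
proof -
  interpret bounded_linear l by fact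
  have "k_smooth_on m S g \<Longrightarrow> k_smooth_on m R (\<lambda>x. g (a + l x))" for m
  proof (induction m arbitrary: g)
    case 0
    then show ?case
      using continuous_on_compose2[of S g R, OF _ continuous_on_add[OF continuous_on_const
            linear_continuous_on[OF assms(1)]]] assms(5)
      by (simp add: image_subset_iff)
  next
    case (Suc m)
    have "((\<lambda>x. a + l x) has_derivative l) (at x)" for x
      by (auto intro!: derivative_eq_intros bounded_linear_imp_has_derivative assms)
    then have "((\<lambda>x. g (a + l x)) has_derivative
        (\<lambda>v. frechet_derivative g (at (a + l x)) (l v))) (at x)" if "x \<in> R" for x
      using has_derivative_compose[of "\<lambda>x. a + l x" l x UNIV g]
        k_smooth_on_has_derivative[OF Suc.prems assms(5)[OF that]] by auto
    then show ?case
      using k_smooth_on_SucI[OF \<open>open R\<close>, where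
          D = "\<lambda>x v. frechet_derivative g (at (a + l x)) (l v)" and m = m and g = "\<lambda>x. g (a + l x)"]
        Suc.IH[OF k_smooth_on_Suc_frechet[OF Suc.prems]] by auto
  qed
  then show ?thesis using assms by (simp add: smooth_on_def)
qed

text \<open>For a real argument the chain rule gives a real number, the derivative of
  \<open>u\<close> along \<open>v\<close>, times the derivative of \<open>g\<close> at
  \<open>u x\<close>. So the bilinear rule and the induction hypothesis apply.\<close>

lemma smooth_on_compose_real:
  fixes g :: "real \<Rightarrow> 'b::real_normed_vector" and u :: "'a::real_normed_vector \<Rightarrow> real"
  assumes "open S" "smooth_on UNIV g" "smooth_on S u"
  shows "smooth_on S (\<lambda>x. g (u x))"
proof -
  have "k_smooth_on m UNIV g \<Longrightarrow> k_smooth_on m S u \<Longrightarrow> k_smooth_on m S (\<lambda>x. g (u x))" for m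
  proof (induction m arbitrary: g)
    case 0
    then show ?case by (auto intro: continuous_on_compose2[of UNIV g S u])
  next
    case (Suc m)
    have lin: "frechet_derivative g (at y) v = v *\<^sub>R frechet_derivative g (at y) 1" for y v
      using linear_cmul[OF has_derivative_linear[OF k_smooth_on_has_derivative[OF Suc.prems(1)]], of y v 1]
      by simp
    have "((\<lambda>x. g (u x)) has_derivative
        (\<lambda>v. frechet_derivative g (at (u x)) (frechet_derivative u (at x) v))) (at x)" if "x \<in> S" for x
      using has_derivative_compose[of u _ x UNIV g]
        k_smooth_on_has_derivative[OF Suc.prems(1)] k_smooth_on_has_derivative[OF Suc.prems(2) that]
      by blast
    then have d: "((\<lambda>x. g (u x)) has_derivative
        (\<lambda>v. frechet_derivative u (at x) v *\<^sub>R frechet_derivative g (at (u x)) 1)) (at x)"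
      if "x \<in> S" for x
      using that by (subst (asm) lin) auto
    show ?case
    proof (rule k_smooth_on_SucI[OF \<open>open S\<close> d])
      fix v
      show "k_smooth_on m S
          (\<lambda>x. frechet_derivative u (at x) v *\<^sub>R frechet_derivative g (at (u x)) 1)"
        by (intro k_smooth_on_bilinear[OF bounded_bilinear_scaleR \<open>open S\<close>] Suc.IH
            k_smooth_on_mono[OF Suc.prems(2)] k_smooth_on_Suc_frechet Suc.prems)
    qed auto
  qed
  then show ?thesis using assms by (simp add: smooth_on_def)
qed

text \<open>The real derivative is multiplication by \<open>deriv h x\<close>, and
  \<open>deriv h x * v\<close> is holomorphic in \<open>x\<close> again.\<close>

lemma holomorphic_imp_smooth_on:
  assumes "open S" "h holomorphic_on S"
  shows "smooth_on S h"
proof -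
  have "k_smooth_on m S h" for m
    using assms(2)
  proof (induction m arbitrary: h)
    case 0
    then show ?case by (simp add: holomorphic_on_imp_continuous_on)
  next
    case (Suc m)
    show ?case
    proof (rule k_smooth_on_SucI[OF \<open>open S\<close>, where D = "\<lambda>x v. deriv h x * v"])
      show "(h has_derivative (\<lambda>v. deriv h x * v)) (at x)" if "x \<in> S" for x
        using holomorphic_derivI[OF Suc.prems \<open>open S\<close> that] by (simp add: has_field_derivative_def)
      show "k_smooth_on m S (\<lambda>x. deriv h x * v)" for v
        by (intro Suc.IH holomorphic_intros holomorphic_deriv Suc.prems \<open>open S\<close>)
    qed
  qed
  then show ?thesis by (simp add: smooth_on_def)
qed

text \<open>The class of functions \<open>p(1/x) exp(-1/x)\<close>, \<open>p\<close> a polynomial, extended by \<open>0\<close> to \<open>x \<le> 0\<close>,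
  is closed under differentiation.\<close>

definition flat_exp :: "real poly \<Rightarrow> real \<Rightarrow> real" where
  "flat_exp p x = (if 0 < x then poly p (1/x) * exp (- (1/x)) else 0)"

lemma poly_times_exp_neg_tendsto_0:
  "((\<lambda>x::real. poly p x * exp (- x)) \<longlongrightarrow> 0) at_top"
proof -
  have "((\<lambda>x::real. \<Sum>i\<le>degree p. coeff p i * (x ^ i / exp x)) \<longlongrightarrow> (\<Sum>i\<le>degree p. coeff p i * 0)) at_top"
    by (intro tendsto_intros tendsto_power_div_exp_0)
  then show ?thesis
    by (simp add: poly_altdef exp_minus sum_distrib_right divide_inverse mult.assoc)
qed

text \<open>For x > 0 and y = 1/x the chain rule gives y^2 (p(y) - p'(y)) exp(-y), and
  \<open>[:0, 0, 1:]\<close> is the polynomial y^2. At 0 the exponential beats every polynomial in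
  y.\<close>

lemma flat_exp_has_derivative:
  "(flat_exp p has_real_derivative flat_exp ([:0, 0, 1:] * (p - pderiv p)) x) (at x)"
proof -
  consider "x < 0" | "x = 0" | "x > 0" by linarith
  then show ?thesis
  proof cases
    case 1
    have "((\<lambda>_. 0) has_real_derivative 0) (at x)" by simp
    then have "(flat_exp p has_real_derivative 0) (at x)"
      by (rule DERIV_cong_ev[THEN iffD1, OF refl _ refl, rotated])
        (use eventually_nhds_in_open[of "{..<0}" x] 1 in \<open>auto simp: flat_exp_def elim!: eventually_mono\<close>)
    then show ?thesis using 1 by (simp add: flat_exp_def)
  next
    case 2
    \<comment> \<open>\<open>pCons 0 p\<close> is y p(y); with y = 1/h the extra factor y is the
      division by h in the difference quotient.\<close>
    have "((\<lambda>h. poly (pCons 0 p) (inverse h) * exp (- (inverse h))) \<longlongrightarrow> 0) (at_right 0)"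
      by (rule filterlim_compose[OF poly_times_exp_neg_tendsto_0 filterlim_inverse_at_top_right])
    then have "((\<lambda>h. flat_exp p h / h) \<longlongrightarrow> 0) (at_right 0)"
      by (rule Lim_transform_eventually)
        (auto simp: flat_exp_def eventually_at_right_field field_simps intro!: exI[of _ 1])
    moreover have "((\<lambda>h. flat_exp p h / h) \<longlongrightarrow> 0) (at_left 0)"
      by (rule Lim_transform_eventually[of "\<lambda>_. 0"])
        (auto simp: flat_exp_def eventually_at_left_field intro!: exI[of _ "-1"])
    ultimately have "((\<lambda>h. flat_exp p h / h) \<longlongrightarrow> 0) (at 0)"
      by (simp add: filterlim_at_split)
    then show ?thesis using 2 by (simp add: DERIV_def flat_exp_def)
  next
    case 3
    have "((\<lambda>x. poly p (1/x) * exp (- (1/x))) has_real_derivative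
        flat_exp ([:0, 0, 1:] * (p - pderiv p)) x) (at x)"
    proof -
      have i: "((\<lambda>x. 1/x) has_real_derivative - ((1/x)^2)) (at x)"
        using 3 by (auto intro!: derivative_eq_intros simp: field_simps power2_eq_square)
      have p: "((\<lambda>x. poly p (1/x)) has_real_derivative poly (pderiv p) (1/x) * - ((1/x)^2)) (at x)"
        by (rule DERIV_chain2[OF poly_DERIV i])
      have e: "((\<lambda>x. exp (- (1/x))) has_real_derivative exp (- (1/x)) * - (- ((1/x)^2))) (at x)"
        by (rule DERIV_fun_exp[OF DERIV_minus[OF i]])
      show ?thesis
        by (rule DERIV_cong[OF DERIV_mult[OF p e]])
          (use 3 in \<open>simp add: flat_exp_def power2_eq_square algebra_simps\<close>)
    qed
    then show ?thesis
      by (rule DERIV_cong_ev[THEN iffD1, OF refl _ refl, rotated])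
        (use eventually_nhds_in_open[of "{0<..}" x] 3 in \<open>auto simp: flat_exp_def elim!: eventually_mono\<close>)
  qed
qed

lemma smooth_on_flat_exp: "smooth_on UNIV (flat_exp p)"
proof -
  \<comment> \<open>The constant \<open>c\<close> makes room for the direction: the derivative along
    \<open>v\<close> is \<open>v * c\<close> times a function of the same class.\<close>
  have "k_smooth_on m UNIV (\<lambda>x. c * flat_exp p x)" for m c
  proof (induction m arbitrary: p c)
    case 0
    have "continuous_on UNIV (flat_exp p)"
      using DERIV_isCont[OF flat_exp_has_derivative] by (simp add: continuous_on_eq_continuous_at)
    then show ?case by (auto intro: continuous_intros)
  next
    case (Suc m)
    show ?case
    proof (rule k_smooth_on_SucI[OF open_UNIV])
      show "((\<lambda>x. c * flat_exp p x) has_derivative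
          (\<lambda>v. (v * c) * flat_exp ([:0, 0, 1:] * (p - pderiv p)) x)) (at x)" for x
        using DERIV_cmult[OF flat_exp_has_derivative, of c p x]
        by (simp only: has_field_derivative_def mult_commute_abs mult.assoc)
    qed (rule Suc)
  qed
  from this[of _ 1] show ?thesis by (simp add: smooth_on_def)
qed

section \<open>Cutoff functions and integration on Riemann surfaces\<close>

context
  fixes \<A> :: "'p::t2_space chart set"
  assumes surface: "riemann_surface \<A>"
begin

section \<open>Charts and cutoff functions\<close>

lemma chart_open: "c \<in> \<A> \<Longrightarrow> open (fst c)"
  and chart_image_open: "c \<in> \<A> \<Longrightarrow> open (chart_image c)"
  and chart_homeomorphism:
    "c \<in> \<A> \<Longrightarrow> homeomorphism (fst c) (chart_image c) (snd c) (chart_point c)"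
  and transition_holomorphic:
    "c \<in> \<A> \<Longrightarrow> d \<in> \<A> \<Longrightarrow> transition c d holomorphic_on (snd c ` (fst c \<inter> fst d))"
  and surface_compact: "compact (UNIV :: 'p set)"
  using surface unfolding riemann_surface_def by blast+

lemma chart_cover: obtains c where "c \<in> \<A>" "p \<in> fst c"
  using surface unfolding riemann_surface_def by blast

lemma chart_point_inverse: "c \<in> \<A> \<Longrightarrow> q \<in> fst c \<Longrightarrow> chart_point c (snd c q) = q"
  and chart_point_right_inverse: "z \<in> chart_image c \<Longrightarrow> snd c (chart_point c z) = z"
  using chart_homeomorphism[of c] by (auto simp: homeomorphism_def inv_into_into f_inv_into_f)

lemma chart_continuous: "c \<in> \<A> \<Longrightarrow> continuous_on (fst c) (snd c)"
  and chart_point_continuous: "c \<in> \<A> \<Longrightarrow> continuous_on (chart_image c) (chart_point c)"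
  using chart_homeomorphism[of c] by (auto simp: homeomorphism_def)

lemma open_image_chart:
  assumes "c \<in> \<A>" "open U" "U \<subseteq> fst c"
  shows "open (snd c ` U)"
proof -
  have "openin (top_of_set (chart_image c)) (snd c ` U)"
    using homeomorphism_imp_open_map[OF chart_homeomorphism[OF assms(1)]] assms
    by (simp add: openin_open_eq[OF chart_open[OF assms(1)]])
  then show ?thesis using chart_image_open[OF assms(1)] openin_open_trans by blast
qed

text \<open>In one chart around \<open>p\<close> the bump is exp(-1/(r^2 - |z - a|^2)) on a disc,
  and it is 0 elsewhere. Its support lies in the image of the closed disc, which is compact and
  therefore closed, the surface being Hausdorff. This is what makes the extension by 0 smooth in all
  other charts.\<close>

lemma exists_cutoff:
  assumes "open U" "p \<in> U"
  obtains \<phi> :: "'p \<Rightarrow> real" where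
    "\<phi> p \<noteq> 0" "\<And>q. 0 \<le> \<phi> q" "continuous_on UNIV \<phi>" "closure {q. \<phi> q \<noteq> 0} \<subseteq> U"
    "\<And>d. d \<in> \<A> \<Longrightarrow> smooth_on (chart_image d) (\<lambda>z. \<phi> (chart_point d z))"
proof -
  obtain c where c: "c \<in> \<A>" "p \<in> fst c" by (rule chart_cover)
  note [simp] = chart_point_inverse[OF c(1)]
  define a where "a = snd c p"
  have "open (snd c ` (U \<inter> fst c))"
    by (rule open_image_chart[OF c(1)]) (auto simp: assms chart_open[OF c(1)])
  moreover have "a \<in> snd c ` (U \<inter> fst c)" using assms c by (auto simp: a_def)
  ultimately obtain r where r: "0 < r" "cball a r \<subseteq> snd c ` (U \<inter> fst c)"
    using open_contains_cball by blast
  define u where "u = (\<lambda>z::complex. r\<^sup>2 - ((z - a) \<bullet> (z - a)))"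
  define \<phi> where "\<phi> q = (if q \<in> fst c then flat_exp 1 (u (snd c q)) else 0)" for q
  define K where "K = chart_point c ` cball a r"
  have Ksub: "K \<subseteq> U \<inter> fst c"
  proof -
    have "chart_point c (snd c q) \<in> U \<inter> fst c" if "q \<in> U \<inter> fst c" for q
      using that by simp
    then show ?thesis using r(2) unfolding K_def by blast
  qed
  have "compact K" unfolding K_def
    by (intro compact_continuous_image continuous_on_subset[OF chart_point_continuous[OF c(1)]])
      (use r(2) in auto)
  then have "closed K" by (rule compact_imp_closed)
  have flat_pos: "0 \<le> flat_exp 1 y" "flat_exp 1 y \<noteq> 0 \<longleftrightarrow> 0 < y" for y
    by (auto simp: flat_exp_def)
  have K: "q \<in> K" if "\<phi> q \<noteq> 0" for q
  proof -
    have q: "q \<in> fst c" "0 < u (snd c q)" using that flat_pos by (auto simp: \<phi>_def split: if_splits)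
    then have "(norm (snd c q - a))\<^sup>2 < r\<^sup>2" by (simp add: u_def power2_norm_eq_inner)
    then have "norm (snd c q - a) < r" using r(1) by (simp add: power_less_imp_less_base)
    then have "snd c q \<in> cball a r" by (simp add: dist_norm norm_minus_commute)
    then show ?thesis using q unfolding K_def by (metis chart_point_inverse[OF c(1)] imageI)
  qed
  then have closure: "closure {q. \<phi> q \<noteq> 0} \<subseteq> K"
    by (intro closure_minimal \<open>closed K\<close> subsetI) simp
  have u: "smooth_on UNIV u"
  proof -
    have id: "smooth_on UNIV (\<lambda>z::complex. z - a)"
      by (intro holomorphic_imp_smooth_on holomorphic_intros) auto
    have "smooth_on UNIV (\<lambda>z::complex. r\<^sup>2 + - 1 *\<^sub>R ((z - a) \<bullet> (z - a)))"
      by (intro smooth_on_add smooth_on_const smooth_on_bounded_linear[OF bounded_linear_scaleR_right]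
          smooth_on_bilinear[OF bounded_bilinear_inner] id open_UNIV)
    then show ?thesis by (simp add: u_def)
  qed
  have flat_u: "smooth_on UNIV (\<lambda>z. flat_exp 1 (u z))"
    by (rule smooth_on_compose_real[OF open_UNIV smooth_on_flat_exp u])
  have cont: "continuous_on UNIV \<phi>"
  proof -
    have "continuous_on (fst c) (\<lambda>q. flat_exp 1 (u (snd c q)))"
      by (rule continuous_on_compose2[OF smooth_on_continuous[OF flat_u] chart_continuous[OF c(1)]]) auto
    then have "continuous_on (fst c) \<phi>"
      by (rule continuous_on_eq) (simp add: \<phi>_def)
    moreover have "continuous_on (- K) \<phi>"
      by (rule continuous_on_eq[OF continuous_on_const[of _ 0]]) (use K in auto)
    ultimately have "continuous_on (fst c \<union> - K) \<phi>"
      using continuous_on_open_Un chart_open[OF c(1)] \<open>closed K\<close> by blast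
    moreover have "fst c \<union> - K = UNIV" using Ksub by auto
    ultimately show ?thesis by simp
  qed
  have smooth: "smooth_on (chart_image d) (\<lambda>z. \<phi> (chart_point d z))" if d: "d \<in> \<A>" for d
  proof -
    \<comment> \<open>The chart \<open>d\<close> is covered by two open parts: the overlap with
      \<open>c\<close>, where the bump is composed with a holomorphic transition, and the part off
      \<open>K\<close>, where it is 0.\<close>
    let ?S = "snd d ` (fst d \<inter> fst c)" and ?R = "snd d ` (fst d \<inter> - K)"
    note [simp] = chart_point_inverse[OF d]
    have oS: "open ?S" and oR: "open ?R"
      by (rule open_image_chart[OF d]; use chart_open[OF c(1)] chart_open[OF d] \<open>closed K\<close> in auto)+
    have tr: "smooth_on ?S (\<lambda>z. transition d c z - a)"
      by (intro holomorphic_imp_smooth_on holomorphic_intros transition_holomorphic d c oS)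
    have "smooth_on ?S (\<lambda>z. r\<^sup>2 + - 1 *\<^sub>R ((transition d c z - a) \<bullet> (transition d c z - a)))"
      by (intro smooth_on_add smooth_on_const smooth_on_bounded_linear[OF bounded_linear_scaleR_right]
          smooth_on_bilinear[OF bounded_bilinear_inner] tr oS)
    then have "smooth_on ?S (\<lambda>z. u (transition d c z))" by (simp add: u_def)
    from smooth_on_compose_real[OF oS smooth_on_flat_exp this, of 1]
    have S: "smooth_on ?S (\<lambda>z. \<phi> (chart_point d z))"
      by (rule smooth_on_cong[OF oS, THEN iffD1, rotated]) (auto simp: \<phi>_def transition_def)
    have R: "smooth_on ?R (\<lambda>z. \<phi> (chart_point d z))"
      by (rule smooth_on_cong[OF oR, THEN iffD1, rotated, OF smooth_on_const[OF oR, of 0]])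
        (use K in force)
    have "?S \<union> ?R = chart_image d" using Ksub by auto
    then show ?thesis using smooth_on_Un[OF S R oS oR] by simp
  qed
  show ?thesis
  proof
    show "\<phi> p \<noteq> 0" using c r(1) flat_pos by (simp add: \<phi>_def u_def a_def)
    show "0 \<le> \<phi> q" for q by (simp add: \<phi>_def flat_pos)
    show "closure {q. \<phi> q \<noteq> 0} \<subseteq> U" using closure Ksub by blast
  qed (use cont smooth in auto)
qed

text \<open>By compactness finitely many cutoffs, each supported in one chart, have a positive sum;
  dividing by it gives the weights.\<close>

lemma exists_subordinate_partition: "\<exists>D \<rho>. subordinate_partition \<A> D \<rho>"
proof -
  have "\<exists>c \<phi>. c \<in> \<A> \<and> \<phi> p \<noteq> (0::real) \<and> (\<forall>q. 0 \<le> \<phi> q) \<and> continuous_on UNIV \<phi> \<and>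
      closure {q. \<phi> q \<noteq> 0} \<subseteq> fst c" for p :: 'p
  proof -
    obtain c where c: "c \<in> \<A>" "p \<in> fst c" by (rule chart_cover)
    obtain \<phi> :: "'p \<Rightarrow> real" where "\<phi> p \<noteq> 0" "\<And>q. 0 \<le> \<phi> q" "continuous_on UNIV \<phi>"
      "closure {q. \<phi> q \<noteq> 0} \<subseteq> fst c"
      by (rule exists_cutoff[OF chart_open[OF c(1)] c(2)]) (rule that)
    then show ?thesis using c by blast
  qed
  then obtain C \<Phi> where C: "\<And>p. C p \<in> \<A>" and \<Phi>: "\<And>p. \<Phi> p p \<noteq> (0::real)" "\<And>p q. 0 \<le> \<Phi> p q"
    "\<And>p. continuous_on UNIV (\<Phi> p)" "\<And>p::'p. closure {q. \<Phi> p q \<noteq> 0} \<subseteq> fst (C p)"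
    by metis
  have "open {q. \<Phi> p q \<noteq> 0}" for p
    using \<Phi>(3)[of p] by (intro open_Collect_neq continuous_on_const)
  then obtain P where P: "finite P" "(UNIV::'p set) \<subseteq> (\<Union>p\<in>P. {q. \<Phi> p q \<noteq> 0})"
  proof (rule compactE_image[OF surface_compact, of UNIV "\<lambda>p. {q. \<Phi> p q \<noteq> 0}"])
    show "UNIV \<subseteq> (\<Union>p. {q. \<Phi> p q \<noteq> 0})" using \<Phi>(1) by auto
  qed (use that in auto)
  define s where "s q = (\<Sum>p\<in>P. \<Phi> p q)" for q
  have s: "s q > 0" for q
  proof -
    obtain p where "p \<in> P" "\<Phi> p q \<noteq> 0" using P by blast
    then show ?thesis unfolding s_def
      by (intro sum_pos2[OF P(1), of p]) (use \<Phi>(2) in \<open>auto simp: less_le\<close>)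
  qed
  \<comment> \<open>Several points of \<open>P\<close> may share a chart, so the weight of a chart
    collects all of their cutoffs.\<close>
  define \<rho> where "\<rho> c q = (\<Sum>p | p \<in> P \<and> C p = c. \<Phi> p q) / s q" for c q
  have "subordinate_partition \<A> (C ` P) \<rho>"
    unfolding subordinate_partition_def
  proof (intro conjI ballI allI)
    show "finite (C ` P)" "C ` P \<subseteq> \<A>" using P C by auto
    fix c assume "c \<in> C ` P"
    have "s q \<noteq> 0" for q using s[of q] by simp
    then show "continuous_on UNIV (\<rho> c)"
      unfolding \<rho>_def by (intro continuous_intros \<Phi>) (auto simp: s_def intro!: continuous_intros \<Phi>)
    show "0 \<le> \<rho> c q" for q
      unfolding \<rho>_def using s[of q] by (auto intro!: divide_nonneg_pos sum_nonneg \<Phi>)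
    have "{q. \<rho> c q \<noteq> 0} \<subseteq> (\<Union>p\<in>{p\<in>P. C p = c}. {q. \<Phi> p q \<noteq> 0})"
      unfolding \<rho>_def by (auto dest: sum.not_neutral_contains_not_neutral)
    then have "closure {q. \<rho> c q \<noteq> 0} \<subseteq> (\<Union>p\<in>{p\<in>P. C p = c}. closure {q. \<Phi> p q \<noteq> 0})"
      by (intro closure_minimal closed_UN ballI closed_closure
          subset_trans[OF _ UN_mono[OF subset_refl closure_subset]]) (simp_all add: P(1))
    then show "closure {q. \<rho> c q \<noteq> 0} \<subseteq> fst c" using \<Phi>(4) by blast
  next
    fix q
    have "(\<Sum>c\<in>C ` P. \<Sum>p | p \<in> P \<and> C p = c. \<Phi> p q) = s q"
      unfolding s_def using sum.image_gen[OF P(1), of "\<lambda>p. \<Phi> p q" C] by simp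
    then show "(\<Sum>c\<in>C ` P. \<rho> c q) = 1"
      using s[of q] by (simp add: \<rho>_def flip: sum_divide_distrib)
  qed
  then show ?thesis by blast
qed

text \<open>The choice of the partition does not involve the integrand, so one partition serves all
  integrands and two integrals can be compared term by term.\<close>

lemma surface_integral_partition:
  obtains D \<rho> where "subordinate_partition \<A> D \<rho>"
    "\<And>\<eta>. surface_integral \<A> \<eta> =
        (\<Sum>c\<in>D. - 2 * \<i> * set_lebesgue_integral lborel (chart_image c)
                  (\<lambda>z. complex_of_real (\<rho> c (chart_point c z)) * \<eta> c z))"
proof -
  obtain D \<rho> where D: "(D, \<rho>) = (SOME (D, \<rho>). subordinate_partition \<A> D \<rho>)"
    by (metis surj_pair)
  have "subordinate_partition \<A> D \<rho>"
    using someI_ex[of "\<lambda>(D, \<rho>). subordinate_partition \<A> D \<rho>"] exists_subordinate_partition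
    unfolding D[symmetric] by auto
  then show ?thesis
    by (rule that) (simp add: surface_integral_def D[symmetric])
qed

lemma surface_integral_cong:
  assumes "\<And>c z. c \<in> \<A> \<Longrightarrow> z \<in> chart_image c \<Longrightarrow> \<eta> c z = \<eta>' c z"
  shows "surface_integral \<A> \<eta> = surface_integral \<A> \<eta>'"
proof -
  obtain D \<rho> where D: "subordinate_partition \<A> D \<rho>"
    "\<And>\<eta>. surface_integral \<A> \<eta> =
        (\<Sum>c\<in>D. - 2 * \<i> * set_lebesgue_integral lborel (chart_image c)
                  (\<lambda>z. complex_of_real (\<rho> c (chart_point c z)) * \<eta> c z))"
    by (rule surface_integral_partition) blast
  have "D \<subseteq> \<A>" using D(1) by (simp add: subordinate_partition_def)
  then have "set_lebesgue_integral lborel (chart_image c)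
        (\<lambda>z. complex_of_real (\<rho> c (chart_point c z)) * \<eta> c z) =
      set_lebesgue_integral lborel (chart_image c)
        (\<lambda>z. complex_of_real (\<rho> c (chart_point c z)) * \<eta>' c z)" if "c \<in> D" for c
    unfolding set_lebesgue_integral_def
    using assms[OF subsetD[OF _ that]]
    by (intro Bochner_Integration.integral_cong refl) (metis indicator_simps(2) scaleR_zero_left)
  then show ?thesis by (simp add: D(2))
qed

lemma surface_integral_0: "surface_integral \<A> (\<lambda>c z. 0) = 0"
proof -
  obtain D \<rho> where "subordinate_partition \<A> D \<rho>" "\<And>\<eta>. surface_integral \<A> \<eta> =
        (\<Sum>c\<in>D. - 2 * \<i> * set_lebesgue_integral lborel (chart_image c)
                  (\<lambda>z. complex_of_real (\<rho> c (chart_point c z)) * \<eta> c z))"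
    by (rule surface_integral_partition) (rule that)
  then show ?thesis by (simp add: set_lebesgue_integral_def)
qed

end

text \<open>The compact set \<open>K\<close> supplies integrability on the possibly non-compact
  \<open>S\<close>. A nonnegative integrable function with integral 0 vanishes almost everywhere;
  the set where \<open>g\<close> is nonzero is open, and an open null set is empty.\<close>

lemma set_lebesgue_integral_eq_0_imp:
  fixes g :: "complex \<Rightarrow> real"
  assumes "open S" "continuous_on S g" "\<And>z. z \<in> S \<Longrightarrow> 0 \<le> g z"
    and K: "compact K" "K \<subseteq> S" "\<And>z. z \<in> S \<Longrightarrow> g z \<noteq> 0 \<Longrightarrow> z \<in> K"
    and "set_lebesgue_integral lborel S g = 0" "z \<in> S"
  shows "g z = 0"
proof (rule ccontr)
  assume "g z \<noteq> 0"
  let ?f = "\<lambda>z. indicator S z *\<^sub>R g z"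
  have "?f = (\<lambda>z. indicator K z *\<^sub>R g z)"
    using K by (auto simp: fun_eq_iff indicator_def)
  then have "integrable lborel ?f"
    using borel_integrable_compact[OF K(1) continuous_on_subset[OF assms(2) K(2)]] by simp
  moreover have "0 \<le> ?f z" for z using assms(3) by (simp add: indicator_def)
  ultimately have "AE z in lborel. ?f z = 0"
    using assms(7) integral_nonneg_eq_0_iff_AE[of lborel ?f] by (simp add: set_lebesgue_integral_def)
  moreover define U where "U = {z\<in>S. g z \<in> - {0}}"
  have "open U"
    unfolding U_def by (rule continuous_open_preimage[OF assms(2,1), unfolded vimage_def Int_def, simplified])
       auto
  ultimately have "AE z in lborel. z \<notin> U"
    by (auto simp: U_def indicator_def elim!: eventually_mono)
  then have "U \<in> null_sets lborel"
    using \<open>open U\<close> AE_iff_null_sets[of U lborel] by simp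
  then have "negligible U"
    using negligible_iff_null_sets null_sets_completionI by blast
  moreover have "z \<in> U" using assms(8) \<open>g z \<noteq> 0\<close> by (simp add: U_def)
  ultimately show False using open_not_negligible[OF \<open>open U\<close>] by blast
qed

text \<open>All summands share the factor -2i and are otherwise nonnegative, so each of them
  vanishes. The chart obtained is one whose weight is nonzero at \<open>p\<close>; a chart with
  weight 0 there gives no information about \<open>h\<close> at \<open>p\<close>.\<close>

lemma surface_integral_nonneg_eq_0_imp:
  fixes \<A> :: "'p::t2_space chart set"
  assumes surface: "riemann_surface \<A>"
    and cont: "\<And>c. c \<in> \<A> \<Longrightarrow> continuous_on (chart_image c) (h c)"
    and nonneg: "\<And>c z. c \<in> \<A> \<Longrightarrow> z \<in> chart_image c \<Longrightarrow> 0 \<le> h c z"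
    and zero: "surface_integral \<A> (\<lambda>c z. complex_of_real (h c z)) = 0"
  obtains c where "c \<in> \<A>" "p \<in> fst c" "h c (snd c p) = 0"
proof -
  obtain D \<rho> where D: "subordinate_partition \<A> D \<rho>"
    "\<And>\<eta>. surface_integral \<A> \<eta> =
        (\<Sum>c\<in>D. - 2 * \<i> * set_lebesgue_integral lborel (chart_image c)
                  (\<lambda>z. complex_of_real (\<rho> c (chart_point c z)) * \<eta> c z))"
    using surface_integral_partition[OF surface] by blast
  let ?g = "\<lambda>c z. \<rho> c (chart_point c z) * h c z"
  let ?I = "\<lambda>c. set_lebesgue_integral lborel (chart_image c) (?g c)"
  have DA: "finite D" "D \<subseteq> \<A>" and sum1: "\<And>p. (\<Sum>c\<in>D. \<rho> c p) = 1"
    and \<rho>: "\<And>c. c \<in> D \<Longrightarrow> continuous_on UNIV (\<rho> c)" "\<And>c p. c \<in> D \<Longrightarrow> 0 \<le> \<rho> c p"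
      "\<And>c. c \<in> D \<Longrightarrow> closure {p. \<rho> c p \<noteq> 0} \<subseteq> fst c"
    using D(1) by (auto simp: subordinate_partition_def)
  have g: "0 \<le> ?g c z" if "c \<in> D" "z \<in> chart_image c" for c z
    using \<rho>(2)[OF that(1)] nonneg[OF subsetD[OF DA(2) that(1)] that(2)] by simp
  have "set_lebesgue_integral lborel (chart_image c)
                  (\<lambda>z. complex_of_real (\<rho> c (chart_point c z)) * complex_of_real (h c z)) =
      complex_of_real (?I c)" for c
    unfolding set_lebesgue_integral_def
    by (subst integral_complex_of_real[symmetric]) (simp add: scaleR_conv_of_real)
  then have "(\<Sum>c\<in>D. - 2 * \<i> * complex_of_real (?I c)) = 0"
    using zero by (simp add: D(2))
  then have "- 2 * \<i> * complex_of_real (\<Sum>c\<in>D. ?I c) = 0"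
    by (simp add: sum_distrib_left)
  then have "(\<Sum>c\<in>D. ?I c) = 0" by (simp del: of_real_sum)
  moreover have "0 \<le> ?I c" if "c \<in> D" for c
    unfolding set_lebesgue_integral_def
    by (rule Bochner_Integration.integral_nonneg) (use g[OF that] in \<open>auto simp: indicator_def\<close>)
  ultimately have I0: "?I c = 0" if "c \<in> D" for c
    using that sum_nonneg_eq_0_iff[OF DA(1), of ?I] by simp
  obtain c where c: "c \<in> D" "\<rho> c p \<noteq> 0"
    using sum1[of p] by (metis (no_types, lifting) sum.neutral zero_neq_one)
  have cA: "c \<in> \<A>" using c DA by auto
  have p: "p \<in> fst c" using \<rho>(3)[OF c(1)] c(2) closure_subset by fastforce
  have "?g c (snd c p) = 0"
  proof (rule set_lebesgue_integral_eq_0_imp[OF chart_image_open[OF surface cA] _ g[OF c(1)] _ _ _ I0[OF c(1)]])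
    show "continuous_on (chart_image c) (?g c)"
      by (intro continuous_on_mult cont cA continuous_on_compose2[OF \<rho>(1)[OF c(1)]]
          chart_point_continuous[OF surface]) auto
    \<comment> \<open>The support of the weight is closed in a compact surface and lies in the
      chart; its image is the compact set that makes the integrand integrable.\<close>
    show "compact (snd c ` closure {p. \<rho> c p \<noteq> 0})"
      using \<rho>(3)[OF c(1)] compact_Int_closed[OF surface_compact[OF surface], of "closure {p. \<rho> c p \<noteq> 0}"]
      by (intro compact_continuous_image continuous_on_subset[OF chart_continuous[OF surface cA]]) auto
    show "snd c ` closure {p. \<rho> c p \<noteq> 0} \<subseteq> chart_image c"
      using \<rho>(3)[OF c(1)] by blast
    show "z \<in> snd c ` closure {p. \<rho> c p \<noteq> 0}" if "z \<in> chart_image c" "?g c z \<noteq> 0" for z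
    proof -
      have "chart_point c z \<in> closure {p. \<rho> c p \<noteq> 0}"
        using that closure_subset by fastforce
      then show ?thesis using chart_point_right_inverse[OF surface that(1)] by (metis imageI)
    qed
  qed (use p in auto)
  then have "h c (snd c p) = 0" using c p chart_point_inverse[OF surface cA] by simp
  then show ?thesis using that cA p by blast
qed

section \<open>Matrix algebra\<close>

lemma cscale_nth [simp]: "cscale u A $ i $ j = u * A $ i $ j"
  by (simp add: cscale_def map_matrix_def)

lemma bounded_bilinear_matrix_mult:
  "bounded_bilinear ((**) :: complex^'n^'n \<Rightarrow> complex^'n^'n \<Rightarrow> complex^'n^'n)"
  unfolding bilinear_conv_bounded_bilinear[symmetric] bilinear_def
  by (auto intro!: linearI simp: vec_eq_iff matrix_matrix_mult_def sum.distrib scaleR_sum_right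
      algebra_simps)

lemma bounded_bilinear_cscale:
  "bounded_bilinear (cscale :: complex \<Rightarrow> complex^'n^'n \<Rightarrow> complex^'n^'n)"
  unfolding bilinear_conv_bounded_bilinear[symmetric] bilinear_def
  by (auto intro!: linearI simp: vec_eq_iff algebra_simps)

lemma bounded_linear_trace: "bounded_linear (trace :: complex^'n^'n \<Rightarrow> complex)"
  unfolding linear_conv_bounded_linear[symmetric]
  by (auto intro!: linearI simp: trace_def sum.distrib scaleR_sum_right)

lemma trace_cscale: "trace (cscale u A) = u * trace A"
  by (simp add: trace_def sum_distrib_left)

lemma cscale_0 [simp]: "cscale u 0 = 0"
  by (simp add: vec_eq_iff)

lemma cscale_matrix_mult_left: "cscale u A ** B = cscale u (A ** B)"
  and cscale_matrix_mult_right: "A ** cscale u B = cscale u (A ** B)"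
  by (simp_all add: vec_eq_iff matrix_matrix_mult_def sum_distrib_left mult_ac)

definition adjoint_mat :: "complex^'n^'n \<Rightarrow> complex^'n^'n" where
  "adjoint_mat A = (\<chi> i j. cnj (A $ j $ i))"

text \<open>Over the complex numbers the map is conjugate-linear; real linearity is what smoothness
  in the real sense asks for.\<close>

lemma bounded_linear_adjoint_mat: "bounded_linear (adjoint_mat :: complex^'n^'n \<Rightarrow> _)"
  unfolding linear_conv_bounded_linear[symmetric]
  by (auto intro!: linearI simp: adjoint_mat_def vec_eq_iff)

text \<open>The norm of \<open>complex^'n^'n\<close> is the Frobenius norm.\<close>

lemma trace_mult_adjoint_mat: "trace (A ** adjoint_mat A) = complex_of_real ((norm A)\<^sup>2)"
proof -
  have "(norm A)\<^sup>2 = (\<Sum>i\<in>UNIV. \<Sum>j\<in>UNIV. (cmod (A $ i $ j))\<^sup>2)"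
    by (simp add: norm_vec_def L2_set_def sum_nonneg)
  then show ?thesis
    by (simp add: trace_def matrix_matrix_mult_def adjoint_mat_def complex_norm_square
        flip: of_real_power)
qed

section \<open>Forms annihilated by all test forms\<close>

text \<open>Circle integrals see a loop on \<open>{0..2 * pi}\<close> only; every other point is
  moved there by a whole number of periods.\<close>

lemma circle_periodic_representative:
  assumes "circle_periodic g"
  obtains y where "y \<in> {0..2 * pi}" "g x = g y"
proof -
  have nat: "g (x + real m * (2 * pi)) = g x" for m x
  proof (induction m)
    case (Suc m)
    have "g (x + real (Suc m) * (2 * pi)) = g ((x + real m * (2 * pi)) + 2 * pi)"
      by (simp add: algebra_simps)
    then show ?case using assms Suc by (simp add: circle_periodic_def)
  qed simp
  have int: "g (x + of_int m * (2 * pi)) = g x" for m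
  proof (cases "m \<ge> 0")
    case True
    then show ?thesis using nat[of x "nat m"] by simp
  next
    case False
    then show ?thesis using nat[of "x + of_int m * (2 * pi)" "nat (- m)"] by simp
  qed
  define m where "m = \<lfloor>x / (2 * pi)\<rfloor>"
  have "of_int m \<le> x / (2 * pi)" "x / (2 * pi) \<le> of_int m + 1" unfolding m_def by linarith+
  then have "of_int m * (2 * pi) \<le> x" "x \<le> (of_int m + 1) * (2 * pi)"
    using pi_gt_zero by (simp_all add: pos_le_divide_eq pos_divide_le_eq del: pi_gt_zero)
  then have "x + of_int (- m) * (2 * pi) \<in> {0..2 * pi}"
    by (simp add: algebra_simps)
  then show ?thesis using that int[of "- m"] by metis
qed

context
  fixes \<A> :: "'p::t2_space chart set" and n :: nat and pts :: "nat \<Rightarrow> 'p"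
  assumes surface: "riemann_surface \<A>"
begin

section \<open>Marked points and forms with poles there\<close>

lemma marks_closed: "closed (marks n pts)"
  unfolding marks_def by (intro finite_imp_closed) simp

lemma regular_image_open: "c \<in> \<A> \<Longrightarrow> open (regular_image n pts c)"
  unfolding regular_image_def
  by (intro open_image_chart[OF surface] open_Diff marks_closed chart_open[OF surface]) auto

lemma regular_image_subset: "regular_image n pts c \<subseteq> chart_image c"
  unfolding regular_image_def by auto

lemma marks_poly_nonzero:
  assumes "c \<in> \<A>" "z \<in> regular_image n pts c"
  shows "marks_poly n pts c z \<noteq> 0"
proof -
  obtain p where p: "p \<in> fst c" "p \<notin> marks n pts" "z = snd c p"
    using assms(2) unfolding regular_image_def by blast
  have "snd c p \<noteq> snd c q" if "q \<in> marks n pts \<inter> fst c" for q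
    using chart_point_inverse[OF surface assms(1)] p that by (metis IntD1 IntD2)
  moreover have "finite (marks n pts \<inter> fst c)" by (simp add: marks_def)
  ultimately show ?thesis using p by (simp add: marks_poly_def)
qed

lemma smooth_on_inverse_marks_poly:
  assumes "c \<in> \<A>"
  shows "smooth_on (regular_image n pts c) (\<lambda>z. 1 / marks_poly n pts c z)"
proof (rule holomorphic_imp_smooth_on[OF regular_image_open[OF assms]])
  show "(\<lambda>z. 1 / marks_poly n pts c z) holomorphic_on regular_image n pts c"
    using marks_poly_nonzero[OF assms]
    by (intro holomorphic_intros) (auto simp: marks_poly_def[abs_def] intro!: holomorphic_intros)
qed

text \<open>Off the marked points \<open>V\<close> is the smooth function \<open>g\<close> divided
  by \<open>marks_poly\<close>; off the closed support of \<phi> the product is 0. The support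
  avoids the marked points, so these two open sets cover the chart.\<close>

lemma smooth_on_cutoff_loop_form:
  assumes V: "loop_form10 \<A> n pts V" and c: "c \<in> \<A>"
    and \<phi>: "closure {q. \<phi> q \<noteq> 0} \<inter> marks n pts = {}"
    and smooth: "smooth_on (chart_image c) (\<lambda>z. \<phi> (chart_point c z))"
  shows "smooth_on (chart_image c \<times> UNIV) (\<lambda>(z, x). \<phi> (chart_point c z) *\<^sub>R V c z x)"
proof -
  let ?R = "regular_image n pts c \<times> (UNIV :: real set)"
  let ?S = "snd c ` (fst c - closure {q. \<phi> q \<noteq> 0}) \<times> (UNIV :: real set)"
  note inv [simp] = chart_point_inverse[OF surface c]
  obtain g where g: "smooth_on (chart_image c \<times> UNIV) g"
    "\<And>z x. z \<in> regular_image n pts c \<Longrightarrow> g (z, x) = cscale (marks_poly n pts c z) (V c z x)"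
    using V c unfolding loop_form10_def by metis
  have oR: "open ?R" by (intro open_Times regular_image_open c open_UNIV)
  have oS: "open ?S"
    by (intro open_Times open_UNIV open_image_chart[OF surface c] open_Diff chart_open[OF surface c]
        closed_closure) auto
  have pull: "smooth_on (S \<times> (UNIV :: real set)) (\<lambda>y. h (fst y))" if "smooth_on S h" "open S"
    for S :: "complex set" and h :: "complex \<Rightarrow> 'c::real_normed_vector"
    using smooth_on_compose_affine[OF bounded_linear_fst that(2) _ that(1), of "S \<times> (UNIV::real set)" 0] that(2)
    by (auto simp: open_Times)
  have "smooth_on ?R (\<lambda>y. \<phi> (chart_point c (fst y)) *\<^sub>R cscale (1 / marks_poly n pts c (fst y)) (g y))"
    by (intro smooth_on_bilinear[OF bounded_bilinear_scaleR] smooth_on_bilinear[OF bounded_bilinear_cscale]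
        oR pull regular_image_open c smooth_on_inverse_marks_poly smooth_on_subset[OF g(1)]
        smooth_on_subset[OF smooth] Sigma_mono regular_image_subset order_refl)
  then have R: "smooth_on ?R (\<lambda>(z, x). \<phi> (chart_point c z) *\<^sub>R V c z x)"
    by (rule smooth_on_cong[OF oR, THEN iffD1, rotated])
      (auto simp: g vec_eq_iff marks_poly_nonzero[OF c])
  have S: "smooth_on ?S (\<lambda>(z, x). \<phi> (chart_point c z) *\<^sub>R V c z x)"
  proof (rule smooth_on_cong[OF oS, THEN iffD1, rotated, OF smooth_on_const[OF oS, of 0]])
    show "0 = (case y of (z, x) \<Rightarrow> \<phi> (chart_point c z) *\<^sub>R V c z x)" if y: "y \<in> ?S" for y
    proof -
      obtain q x where q: "y = (snd c q, x)" "q \<in> fst c" "q \<notin> closure {q. \<phi> q \<noteq> 0}"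
        using y by blast
      have "\<phi> q = 0" using q(3) closure_subset[of "{q. \<phi> q \<noteq> 0}"] by blast
      then show ?thesis by (simp add: q(1,2))
    qed
  qed
  have "?R \<union> ?S = chart_image c \<times> UNIV"
    using \<phi> unfolding regular_image_def by blast
  then show ?thesis using smooth_on_Un[OF R S oR oS] by simp
qed

lemma loop_form10_eq_0:
  fixes V :: "('p, 'n::finite) loop_form"
  assumes V: "loop_form10 \<A> n pts V"
    and zero: "\<And>W. loop_form01 \<A> W \<Longrightarrow>
      surface_integral \<A> (\<lambda>c z. circle_integral (\<lambda>x. trace (V c z x ** W c z x))) = 0"
    and c: "c \<in> \<A>" and p: "p \<in> fst c - marks n pts"
  shows "V c (snd c p) x = 0"
proof -
  have "p \<in> - marks n pts" using p by simp
  then obtain \<phi> :: "'p \<Rightarrow> real" where \<phi>: "\<phi> p \<noteq> 0" "closure {q. \<phi> q \<noteq> 0} \<subseteq> - marks n pts"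
    "\<And>d. d \<in> \<A> \<Longrightarrow> smooth_on (chart_image d) (\<lambda>z. \<phi> (chart_point d z))"
    by (rule exists_cutoff[OF surface open_Compl[OF marks_closed]]) (rule that)
  have \<phi>0: "\<phi> q = 0" if "q \<in> marks n pts" for q
    using that \<phi>(2) closure_subset[of "{q. \<phi> q \<noteq> 0}"] by blast
  \<comment> \<open>The factors \<phi> are shared out so that \<open>V ** W\<close> is
    \<open>U\<close> times its conjugate transpose, while \<open>W\<close> is built from
    \<open>U\<close>, which is smooth also at the marked points.\<close>
  define U where "U c z x = \<phi> (chart_point c z) *\<^sub>R V c z x" for c z x
  define W where "W c z x = \<phi> (chart_point c z) *\<^sub>R adjoint_mat (U c z x)" for c z x
  have U: "smooth_on (chart_image c \<times> UNIV) (\<lambda>(z, x). U c z x)" if "c \<in> \<A>" for c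
    unfolding U_def
    by (rule smooth_on_cutoff_loop_form[OF V that _ \<phi>(3)[OF that]]) (use \<phi>(2) in blast)
  have W: "loop_form01 \<A> W"
    unfolding loop_form01_def
  proof (intro conjI ballI allI)
    fix c assume c: "c \<in> \<A>"
    have o: "open (chart_image c \<times> (UNIV :: real set))"
      by (intro open_Times open_UNIV chart_image_open[OF surface c])
    have "smooth_on (chart_image c \<times> (UNIV :: real set)) (\<lambda>y. \<phi> (chart_point c (0 + fst y)))"
      by (rule smooth_on_compose_affine[OF bounded_linear_fst _ o \<phi>(3)[OF c]])
        (auto simp: chart_image_open[OF surface c])
    from smooth_on_bilinear[OF bounded_bilinear_scaleR o this
        smooth_on_bounded_linear[OF bounded_linear_adjoint_mat o U[OF c]]]
    show "smooth_on (chart_image c \<times> UNIV) (\<lambda>(z, x). W c z x)"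
      by (simp add: W_def case_prod_unfold)
    fix z assume z: "z \<in> chart_image c"
    show "circle_periodic (W c z)"
    proof (cases "z \<in> regular_image n pts c")
      case True
      then have "circle_periodic (V c z)" using V c by (simp add: loop_form10_def)
      then show ?thesis by (simp add: circle_periodic_def W_def U_def)
    next
      \<comment> \<open>At a marked point nothing is known about \<open>V\<close>, but there
        \<open>W\<close> is 0.\<close>
      case False
      then have "chart_point c z \<in> marks n pts"
        using z chart_point_inverse[OF surface c] by (auto simp: regular_image_def)
      then show ?thesis by (simp add: circle_periodic_def W_def \<phi>0)
    qed
  next
    fix c d z x assume c: "c \<in> \<A>" and d: "d \<in> \<A>" and "z \<in> snd c ` (fst c \<inter> fst d)"
    then obtain q where q: "q \<in> fst c" "q \<in> fst d" "z = snd c q" by blast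
    have cp: "chart_point c z = q" "transition c d z = snd d q" "chart_point d (snd d q) = q"
      using chart_point_inverse[OF surface] c d q by (simp_all add: transition_def)
    show "W c z x = cscale (cnj (deriv (transition c d) z)) (W d (transition c d z) x)"
    proof (cases "q \<in> marks n pts")
      case False
      then have "V c z x = cscale (deriv (transition c d) z) (V d (transition c d z) x)"
        using V c d q unfolding loop_form10_def by blast
      then show ?thesis
        by (simp add: W_def U_def cp vec_eq_iff adjoint_mat_def)
    qed (simp add: W_def cp \<phi>0)
  qed
  define h where "h c z = integral {0..2 * pi} (\<lambda>x. (norm (U c z x))\<^sup>2)" for c z
  have contU: "continuous_on (chart_image c \<times> cbox 0 (2 * pi)) (\<lambda>(z, x). (norm (U c z x))\<^sup>2)"
    if "c \<in> \<A>" for c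
  proof -
    have "continuous_on (chart_image c \<times> cbox 0 (2 * pi)) (\<lambda>(z, x). U c z x)"
      by (rule continuous_on_subset[OF smooth_on_continuous[OF U[OF that]]]) auto
    then show ?thesis unfolding case_prod_unfold by (intro continuous_intros)
  qed
  have slice: "continuous_on {0..2 * pi} (\<lambda>x. (norm (U c z x))\<^sup>2)"
    if "c \<in> \<A>" "z \<in> chart_image c" for c z
    by (rule continuous_on_compose2[OF contU[OF that(1)], of _ "\<lambda>x. (z, x)", simplified])
      (use that in \<open>auto intro!: continuous_intros\<close>)
  have "surface_integral \<A> (\<lambda>c z. complex_of_real (h c z)) =
      surface_integral \<A> (\<lambda>c z. circle_integral (\<lambda>x. trace (V c z x ** W c z x)))"
  proof (rule surface_integral_cong[OF surface])
    fix c z assume cz: "c \<in> \<A>" "z \<in> chart_image c"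
    have "V c z x ** W c z x = U c z x ** adjoint_mat (U c z x)" for x
      by (simp add: W_def U_def vec_eq_iff matrix_matrix_mult_def adjoint_mat_def
          sum_distrib_left scaleR_sum_right algebra_simps)
    then have "trace (V c z x ** W c z x) = complex_of_real ((norm (U c z x))\<^sup>2)" for x
      by (simp add: trace_mult_adjoint_mat)
    then show "complex_of_real (h c z) = circle_integral (\<lambda>x. trace (V c z x ** W c z x))"
      unfolding h_def circle_integral_def
      using integral_linear[OF integrable_continuous_real[OF slice[OF cz]]
          bounded_linear_of_real[where 'a = complex]]
      by (simp add: o_def)
  qed
  then have h0: "surface_integral \<A> (\<lambda>c z. complex_of_real (h c z)) = 0"
    using zero[OF W] by simp
  \<comment> \<open>\<open>d\<close> need not be \<open>c\<close>: vanishing is obtained in one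
    chart around \<open>p\<close> and then carried to \<open>c\<close> by the transition law of
    \<open>V\<close>.\<close>
  obtain d where d: "d \<in> \<A>" "p \<in> fst d" "h d (snd d p) = 0"
  proof (rule surface_integral_nonneg_eq_0_imp[OF surface _ _ h0])
    show "continuous_on (chart_image c) (h c)" if "c \<in> \<A>" for c
      unfolding h_def using integral_continuous_on_param[OF contU[OF that]] by simp
    show "0 \<le> h c z" if "c \<in> \<A>" "z \<in> chart_image c" for c z
      unfolding h_def by (intro integral_nonneg integrable_continuous_real slice that) auto
  qed (rule that)
  have dz: "snd d p \<in> chart_image d" using d by blast
  have "V d (snd d p) y = 0" if "y \<in> {0..2 * pi}" for y
  proof -
    have "\<forall>x\<in>{0..2 * pi}. (norm (U d (snd d p) x))\<^sup>2 = 0"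
      using integral_eq_0_iff[OF slice[OF d(1) dz]] d(3) by (simp add: h_def)
    then show ?thesis
      using that \<phi>(1) chart_point_inverse[OF surface d(1,2)] by (simp add: U_def)
  qed
  moreover have "circle_periodic (V d (snd d p))"
    using V d p unfolding loop_form10_def regular_image_def by blast
  ultimately have "V d (snd d p) x = 0"
    by (metis circle_periodic_representative)
  moreover have "V c (snd c p) x =
      cscale (deriv (transition c d) (snd c p)) (V d (transition c d (snd c p)) x)"
    using V c d p unfolding loop_form10_def by blast
  moreover have "transition c d (snd c p) = snd d p"
    using chart_point_inverse[OF surface c] p by (simp add: transition_def)
  ultimately show ?thesis by simp
qed

text \<open>As scalar matrices that are constant in x, scalar forms inherit the smoothness of
  cut-off loop forms.\<close>

lemma scalar_form10_imp_loop_form10: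
  assumes "scalar_form10 \<A> n pts k"
  shows "loop_form10 \<A> n pts (\<lambda>c z x. cscale (k c z) (mat 1 :: complex^'n::finite^'n))"
  unfolding loop_form10_def
proof (intro conjI ballI allI)
  fix c assume c: "c \<in> \<A>"
  obtain g where g: "smooth_on (chart_image c) g"
      "\<And>z. z \<in> regular_image n pts c \<Longrightarrow> g z = marks_poly n pts c z * k c z"
    using assms c unfolding scalar_form10_def by metis
  have o: "open (chart_image c \<times> (UNIV :: real set))"
    by (intro open_Times open_UNIV chart_image_open[OF surface c])
  have "smooth_on (chart_image c \<times> (UNIV :: real set)) (\<lambda>y. cscale (g (0 + fst y)) (mat 1 :: complex^'n^'n))"
    by (rule smooth_on_bilinear[OF bounded_bilinear_cscale o
          smooth_on_compose_affine[OF bounded_linear_fst chart_image_open[OF surface c] o g(1)]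
          smooth_on_const[OF o]]) auto
  then show "\<exists>g. smooth_on (chart_image c \<times> (UNIV :: real set)) g \<and> (\<forall>z\<in>regular_image n pts c. \<forall>x.
      g (z, x) = cscale (marks_poly n pts c z) (cscale (k c z) (mat 1 :: complex^'n^'n)))"
    by (intro exI[of _ "\<lambda>y. cscale (g (0 + fst y)) (mat 1)"] conjI) (simp_all add: g vec_eq_iff)
next
  fix c d z assume "c \<in> \<A>" "d \<in> \<A>" "z \<in> snd c ` (fst c \<inter> fst d - marks n pts)"
  then have "k c z = deriv (transition c d) z * k d (transition c d z)"
    using assms unfolding scalar_form10_def by blast
  then show "cscale (k c z) (mat 1 :: complex^'n^'n) =
      cscale (deriv (transition c d) z) (cscale (k d (transition c d z)) (mat 1))"
    by (simp add: vec_eq_iff)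
qed (simp add: circle_periodic_def)

lemma scalar_form10_eq_0:
  assumes k: "scalar_form10 \<A> n pts k"
    and zero: "\<And>l. scalar_form01 \<A> l \<Longrightarrow> surface_integral \<A> (\<lambda>c z. k c z * l c z) = 0"
    and c: "c \<in> \<A>" and p: "p \<in> fst c - marks n pts"
  shows "k c (snd c p) = 0"
proof -
  have "p \<in> - marks n pts" using p by simp
  then obtain \<phi> :: "'p \<Rightarrow> real" where \<phi>: "\<phi> p \<noteq> 0" "closure {q. \<phi> q \<noteq> 0} \<subseteq> - marks n pts"
    "\<And>d. d \<in> \<A> \<Longrightarrow> smooth_on (chart_image d) (\<lambda>z. \<phi> (chart_point d z))"
    by (rule exists_cutoff[OF surface open_Compl[OF marks_closed]]) (rule that)
  have \<phi>0: "\<phi> q = 0" if "q \<in> marks n pts" for q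
    using that \<phi>(2) closure_subset[of "{q. \<phi> q \<noteq> 0}"] by blast
  define u where "u c z = \<phi> (chart_point c z) *\<^sub>R k c z" for c z
  define l where "l c z = \<phi> (chart_point c z) *\<^sub>R cnj (u c z)" for c z
  have u: "smooth_on (chart_image c) (u c)" if c: "c \<in> \<A>" for c
  proof -
    \<comment> \<open>\<open>k\<close> is treated as a form of 1 by 1 matrices; freezing x at 0 and
      reading off the single entry leads back to scalars.\<close>
    have "smooth_on (chart_image c \<times> UNIV)
        (\<lambda>(z, x::real). \<phi> (chart_point c z) *\<^sub>R cscale (k c z) (mat 1 :: complex^1^1))"
      by (rule smooth_on_cutoff_loop_form[OF scalar_form10_imp_loop_form10[OF k] c _ \<phi>(3)[OF c]])
        (use \<phi>(2) in blast)
    then have "smooth_on (chart_image c) (\<lambda>z. case (0, 0) + (z, 0) of (z, x::real) \<Rightarrow>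
        \<phi> (chart_point c z) *\<^sub>R cscale (k c z) (mat 1 :: complex^1^1))"
      by (rule smooth_on_compose_affine[rotated 3])
        (auto intro!: bounded_linear_Pair bounded_linear_ident bounded_linear_zero open_Times
          chart_image_open[OF surface c])
    from smooth_on_bounded_linear[OF bounded_linear_compose[OF bounded_linear_vec_nth[of 1] bounded_linear_vec_nth[of 1]]
        chart_image_open[OF surface c] this]
    show ?thesis by (simp add: u_def[abs_def] mat_def)
  qed
  have l: "scalar_form01 \<A> l"
    unfolding scalar_form01_def
  proof (intro conjI ballI)
    fix c assume c: "c \<in> \<A>"
    show "smooth_on (chart_image c) (l c)"
      unfolding l_def[abs_def]
      by (intro smooth_on_bilinear[OF bounded_bilinear_scaleR] smooth_on_bounded_linear[OF bounded_linear_cnj]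
          chart_image_open[OF surface c] u \<phi>(3) c)
  next
    fix c d z assume c: "c \<in> \<A>" and d: "d \<in> \<A>" and "z \<in> snd c ` (fst c \<inter> fst d)"
    then obtain q where q: "q \<in> fst c" "q \<in> fst d" "z = snd c q" by blast
    have cp: "chart_point c z = q" "transition c d z = snd d q" "chart_point d (snd d q) = q"
      using chart_point_inverse[OF surface] c d q by (simp_all add: transition_def)
    show "l c z = cnj (deriv (transition c d) z) * l d (transition c d z)"
    proof (cases "q \<in> marks n pts")
      case False
      then have "k c z = deriv (transition c d) z * k d (transition c d z)"
        using k c d q unfolding scalar_form10_def by blast
      then show ?thesis by (simp add: l_def u_def cp)
    qed (simp add: l_def cp \<phi>0)
  qed
  define h where "h c z = (cmod (u c z))\<^sup>2" for c z
  have "complex_of_real (h c z) = k c z * l c z" for c z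
    unfolding h_def complex_norm_square by (simp add: l_def u_def)
  then have h0: "surface_integral \<A> (\<lambda>c z. complex_of_real (h c z)) = 0"
    using zero[OF l] by simp
  obtain d where d: "d \<in> \<A>" "p \<in> fst d" "h d (snd d p) = 0"
  proof (rule surface_integral_nonneg_eq_0_imp[OF surface _ _ h0])
    show "continuous_on (chart_image c) (h c)" if "c \<in> \<A>" for c
      unfolding h_def by (intro continuous_intros smooth_on_continuous[OF u[OF that]])
  qed (auto simp: h_def intro: that)
  then have "k d (snd d p) = 0"
    using \<phi>(1) chart_point_inverse[OF surface d(1,2)] by (simp add: h_def u_def)
  moreover have "k c (snd c p) = deriv (transition c d) (snd c p) * k d (transition c d (snd c p))"
    using k c d p unfolding scalar_form10_def by blast
  moreover have "transition c d (snd c p) = snd d p"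
    using chart_point_inverse[OF surface c] p by (simp add: transition_def)
  ultimately show ?thesis by simp
qed

end

section \<open>Conservation of \<open>\<Phi>\<close> and \<open>k\<close>\<close>

lemma smooth_on_has_vector_derivative:
  fixes g :: "real \<Rightarrow> 'b::real_normed_vector"
  assumes "smooth_on S g" "x \<in> S"
  shows "(g has_vector_derivative frechet_derivative g (at x) 1) (at x)"
proof -
  note g = smooth_on_has_derivative[OF assms]
  have "frechet_derivative g (at x) = (\<lambda>v. v *\<^sub>R frechet_derivative g (at x) 1)"
  proof
    fix v show "frechet_derivative g (at x) v = v *\<^sub>R frechet_derivative g (at x) 1"
      using linear_cmul[OF has_derivative_linear[OF g], of v 1] by simp
  qed
  then show ?thesis using g unfolding has_vector_derivative_def by metis
qed

section \<open>Loops and the Kirillov-Kostant form\<close>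

lemma smooth_on_dx: "smooth_on UNIV g \<Longrightarrow> smooth_on UNIV (dx g)"
  using smooth_on_frechet[of UNIV g 1] vector_derivative_at[OF smooth_on_has_vector_derivative[of UNIV g]]
  by (simp add: dx_def[abs_def])

lemma dx_has_vector_derivative: "smooth_on UNIV g \<Longrightarrow> (g has_vector_derivative dx g x) (at x)"
  unfolding dx_def by (metis UNIV_I smooth_on_has_vector_derivative vector_derivative_at)

lemma coadjoint_vector_0: "coadjoint_vector q (\<lambda>x. 0) = (\<lambda>x. 0, 0)"
  by (simp add: coadjoint_vector_def dx_def comm_def vec_eq_iff fun_eq_iff matrix_matrix_mult_def)

lemma smooth_loop_0: "smooth_loop (\<lambda>x. 0)"
  by (simp add: smooth_loop_def circle_periodic_def smooth_on_const)

text \<open>The boundary terms cancel by periodicity. In the Kirillov-Kostant form this moves the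
  derivative in the central term to the second generator.\<close>

lemma circle_integral_by_parts:
  assumes \<xi>: "smooth_loop \<xi>" and \<eta>: "smooth_loop \<eta>"
  shows "circle_integral (\<lambda>x. trace (dx \<xi> x ** \<eta> x)) = - circle_integral (\<lambda>x. trace (\<xi> x ** dx \<eta> x))"
proof -
  interpret mult: bounded_bilinear "(**) :: complex^'a^'a \<Rightarrow> complex^'a^'a \<Rightarrow> complex^'a^'a"
    by (rule bounded_bilinear_matrix_mult)
  interpret trace: bounded_linear "trace :: complex^'a^'a \<Rightarrow> complex"
    by (rule bounded_linear_trace)
  have s: "smooth_on UNIV \<xi>" "smooth_on UNIV \<eta>" using assms by (auto simp: smooth_loop_def)
  have per: "\<xi> (2 * pi) = \<xi> 0" "\<eta> (2 * pi) = \<eta> 0"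
    using assms unfolding smooth_loop_def circle_periodic_def by (metis add_0)+
  have "((\<lambda>x. trace (\<xi> x ** dx \<eta> x + dx \<xi> x ** \<eta> x)) has_integral
      (trace (\<xi> (2 * pi) ** \<eta> (2 * pi)) - trace (\<xi> 0 ** \<eta> 0))) {0..2 * pi}"
    by (rule fundamental_theorem_of_calculus[OF _ has_vector_derivative_at_within[
          OF trace.has_vector_derivative[OF mult.has_vector_derivative[
          OF s[THEN dx_has_vector_derivative]]]]]) simp
  then have "integral {0..2 * pi} (\<lambda>x. trace (\<xi> x ** dx \<eta> x) + trace (dx \<xi> x ** \<eta> x)) = 0"
    by (simp add: per trace.add integral_unique)
  moreover have "continuous_on {0..2 * pi} (\<lambda>x. trace (\<xi> x ** dx \<eta> x))"
    "continuous_on {0..2 * pi} (\<lambda>x. trace (dx \<xi> x ** \<eta> x))"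
    by (intro trace.continuous_on mult.continuous_on smooth_on_continuous
        smooth_on_subset[OF smooth_on_dx] smooth_on_subset[OF s(1)] smooth_on_subset[OF s(2)] s subset_UNIV)+
  ultimately show ?thesis
    unfolding circle_integral_def
    by (subst (asm) integral_add) (auto intro: integrable_continuous_real simp: add_eq_0_iff)
qed

text \<open>The chosen generator of the zero vector need not vanish; it lies in the stabilizer of \<open>q\<close>.\<close>

lemma kirillov_kostant_0_right:
  assumes "smooth_loop \<zeta>" "v = coadjoint_vector q \<zeta>"
  shows "kirillov_kostant q v (\<lambda>x. 0, 0) = 0"
proof -
  define \<xi> where "\<xi> = orbit_generator q v"
  define \<eta> where "\<eta> = orbit_generator q (\<lambda>x. 0, 0)"
  have \<xi>: "smooth_loop \<xi>"
    unfolding \<xi>_def orbit_generator_def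
    using someI[of "\<lambda>\<xi>. smooth_loop \<xi> \<and> v = coadjoint_vector q \<xi>" \<zeta>] assms by simp
  have "smooth_loop \<eta> \<and> (\<lambda>x. 0, 0) = coadjoint_vector q \<eta>"
    unfolding \<eta>_def orbit_generator_def
    by (rule someI[of _ "\<lambda>x. 0"]) (simp add: smooth_loop_0 coadjoint_vector_0)
  then have \<eta>: "smooth_loop \<eta>"
    and stab: "cscale (snd q) (dx \<eta> x) + comm (fst q x) (\<eta> x) = 0" for x
    by (auto simp: coadjoint_vector_def fun_eq_iff)
  \<comment> \<open>Cyclicity of the trace turns the left side into the trace of \<xi> [\<eta>, p],
    and the stabilizer equation says that [\<eta>, p] is r times the derivative of \<eta>. After
    integration by parts the two terms of the form cancel.\<close>
  have tr: "trace (fst q x ** comm (\<xi> x) (\<eta> x)) = snd q * trace (\<xi> x ** dx \<eta> x)" for x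
  proof -
    interpret mult: bounded_bilinear "(**) :: complex^'a^'a \<Rightarrow> complex^'a^'a \<Rightarrow> complex^'a^'a"
      by (rule bounded_bilinear_matrix_mult)
    interpret trace: bounded_linear "trace :: complex^'a^'a \<Rightarrow> complex"
      by (rule bounded_linear_trace)
    have "cscale (snd q) (dx \<eta> x) = \<eta> x ** fst q x - fst q x ** \<eta> x"
      using stab[of x] unfolding eq_neg_iff_add_eq_0[symmetric] by (simp add: comm_def)
    then have "snd q * trace (\<xi> x ** dx \<eta> x) = trace (\<xi> x ** (\<eta> x ** fst q x - fst q x ** \<eta> x))"
      by (metis cscale_matrix_mult_right trace_cscale)
    also have "\<dots> = trace (fst q x ** comm (\<xi> x) (\<eta> x))"
      using trace_mul_sym[of "fst q x" "\<xi> x ** \<eta> x"] trace_mul_sym[of "fst q x ** \<eta> x" "\<xi> x"]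
      by (simp add: comm_def mult.diff_right trace.diff matrix_mul_assoc)
    finally show ?thesis by simp
  qed
  show ?thesis
    unfolding kirillov_kostant_def Let_def \<xi>_def[symmetric] \<eta>_def[symmetric]
      circle_integral_by_parts[OF \<xi> \<eta>] tr
    by (simp add: circle_integral_def)
qed

lemma hamiltonian_trajectory_velocity_eq_0:
  fixes X :: "real \<Rightarrow> ('p::t2_space, 'n::finite) hitchin_fields"
  assumes surface: "riemann_surface \<A>"
    and H: "\<And>Y Z. Higgs Y = Higgs Z \<Longrightarrow> kay Y = kay Z \<Longrightarrow> H Y = H Z"
    and flow: "hamiltonian_trajectory \<A> n pts \<O> H T X"
    and t: "t \<in> T" and c: "c \<in> \<A>" and p: "p \<in> fst c - marks n pts"
  shows "Higgs (velocity X t) c (snd c p) x = 0" and "kay (velocity X t) c (snd c p) = 0"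
proof -
  let ?V = "velocity X t"
  define W :: "('p, 'n) loop_form \<Rightarrow> 'p scalar_form \<Rightarrow> ('p, 'n) hitchin_fields" where
    "W w l = \<lparr>Abar = w, Higgs = (\<lambda>c z x. 0), lam = l, kay = (\<lambda>c z. 0), orb = (\<lambda>\<alpha>. (\<lambda>x. 0, 0))\<rparr>" for w l
  have V: "?V \<in> tangent_space \<A> n pts (X t)"
    using flow t unfolding hamiltonian_trajectory_def by blast
  \<comment> \<open>The test vectors do not move the orbits. The form reads even the zero vector
    through a chosen generator, so this term has to be shown to vanish.\<close>
  have "kirillov_kostant (orb (X t) \<alpha>) (orb ?V \<alpha>) (\<lambda>x. 0, 0) = 0" if "\<alpha> < n" for \<alpha>
    using V that unfolding tangent_space_def by (blast intro: kirillov_kostant_0_right)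
  then have kk: "(\<Sum>\<alpha><n. kirillov_kostant (orb (X t) \<alpha>) (orb ?V \<alpha>) (\<lambda>x. 0, 0)) = 0"
    by simp
  \<comment> \<open>One identity serves both velocities: \<open>l\<close> = 0 isolates the Higgs
    field and \<open>w\<close> = 0 isolates \<open>k\<close>.\<close>
  have pair: "surface_integral \<A> (\<lambda>c z. circle_integral (\<lambda>x. trace (Higgs ?V c z x ** w c z x)))
      + surface_integral \<A> (\<lambda>c z. kay ?V c z * l c z) = 0"
    if w: "loop_form01 \<A> w" and l: "scalar_form01 \<A> l" for w l
  proof -
    have Higgs0: "loop_form10 \<A> n pts (\<lambda>c z x. 0 :: complex^'n^'n)"
      unfolding loop_form10_def
      by (auto simp: circle_periodic_def intro!: exI[of _ "\<lambda>_. 0"] smooth_on_const open_Times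
          chart_image_open[OF surface])
    have kay0: "scalar_form10 \<A> n pts (\<lambda>c z. 0)"
      unfolding scalar_form10_def
      by (auto intro!: exI[of _ "\<lambda>_. 0"] smooth_on_const chart_image_open[OF surface])
    have "W w l \<in> tangent_space \<A> n pts (X t)"
      using w l Higgs0 kay0 smooth_loop_0
      by (auto simp: tangent_space_def W_def coadjoint_vector_0 intro!: exI[of _ "\<lambda>x. 0"])
    then have "((\<lambda>\<epsilon>. H (vary (X t) (W w l) \<epsilon>)) has_vector_derivative
        - symplectic_form \<A> n (X t) ?V (W w l)) (at 0)"
      using flow t unfolding hamiltonian_trajectory_def by blast
    \<comment> \<open>The variation adds multiples of 0 to the Higgs field and to \<open>k\<close>,
      so the function being differentiated is constant in \<epsilon>.\<close>
    moreover have "H (vary (X t) (W w l) \<epsilon>) = H (X t)" for \<epsilon>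
      by (rule H) (simp_all add: vary_def W_def)
    ultimately have "((\<lambda>\<epsilon>. H (X t)) has_vector_derivative
        - symplectic_form \<A> n (X t) ?V (W w l)) (at (0::real))"
      by simp
    then have "symplectic_form \<A> n (X t) ?V (W w l) = 0"
      using vector_derivative_unique_at[OF _ has_vector_derivative_const] by fastforce
    moreover have "trace (0 ** A) = 0" for A :: "complex^'n^'n"
      by (simp add: trace_def matrix_matrix_mult_def)
    ultimately show ?thesis
      by (simp add: symplectic_form_def W_def kk)
  qed
  have w0: "loop_form01 \<A> (\<lambda>c z x. 0 :: complex^'n^'n)" and l0: "scalar_form01 \<A> (\<lambda>c z. 0)"
    unfolding loop_form01_def scalar_form01_def
    by (auto simp: circle_periodic_def case_prod_unfold
        intro!: smooth_on_const open_Times chart_image_open[OF surface])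
  have int0: "circle_integral (\<lambda>x. trace (0 :: complex^'n^'n)) = 0"
    by (simp add: circle_integral_def trace_def)
  have forms: "loop_form10 \<A> n pts (Higgs ?V)" "scalar_form10 \<A> n pts (kay ?V)"
    using V by (auto simp: tangent_space_def)
  show "Higgs ?V c (snd c p) x = 0"
    by (rule loop_form10_eq_0[OF surface forms(1) _ c p])
      (use pair[OF _ l0] in \<open>simp add: surface_integral_0[OF surface]\<close>)
  show "kay ?V c (snd c p) = 0"
    by (rule scalar_form10_eq_0[OF surface forms(2) _ c p])
      (use pair[OF w0] in \<open>simp add: int0 surface_integral_0[OF surface]\<close>)
qed

text \<open>\<open>velocity\<close> is built from \<open>vector_derivative\<close>, which has a
  value even where no derivative exists. Differentiability is therefore taken from the smooth
  trajectory, where the fields occur multiplied by \<open>marks_poly\<close>, a nonzero constant in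
  time at the given point.\<close>

lemma hamiltonian_trajectory_has_vector_derivative_0:
  fixes X :: "real \<Rightarrow> ('p::t2_space, 'n::finite) hitchin_fields"
  assumes surface: "riemann_surface \<A>" and T: "open T"
    and H: "\<And>Y Z. Higgs Y = Higgs Z \<Longrightarrow> kay Y = kay Z \<Longrightarrow> H Y = H Z"
    and flow: "hamiltonian_trajectory \<A> n pts \<O> H T X"
    and t: "t \<in> T" and c: "c \<in> \<A>" and p: "p \<in> fst c - marks n pts"
  shows "((\<lambda>\<tau>. Higgs (X \<tau>) c (snd c p) x) has_vector_derivative 0) (at t)"
    and "((\<lambda>\<tau>. kay (X \<tau>) c (snd c p)) has_vector_derivative 0) (at t)"
proof -
  let ?z = "snd c p" and ?m = "marks_poly n pts c (snd c p)"
  have z: "?z \<in> regular_image n pts c" "?z \<in> chart_image c"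
    using p by (auto simp: regular_image_def)
  note m = marks_poly_nonzero[OF surface c z(1)]
  note ci = chart_image_open[OF surface c]
  have traj: "smooth_trajectory \<A> n pts T X"
    using flow by (simp add: hamiltonian_trajectory_def)
  obtain g where g: "smooth_on (T \<times> chart_image c \<times> UNIV) g"
    "\<And>\<tau>. \<tau> \<in> T \<Longrightarrow> g (\<tau>, ?z, x) = cscale ?m (Higgs (X \<tau>) c ?z x)"
    using traj c z unfolding smooth_trajectory_def by metis
  obtain g' where g': "smooth_on (T \<times> chart_image c) g'"
    "\<And>\<tau>. \<tau> \<in> T \<Longrightarrow> g' (\<tau>, ?z) = ?m * kay (X \<tau>) c ?z"
    using traj c z unfolding smooth_trajectory_def by metis
  have "smooth_on T (\<lambda>\<tau>. g ((0, ?z, x) + (\<tau>, 0, 0)))"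
    by (rule smooth_on_compose_affine[OF _ _ T g(1)])
      (auto intro!: bounded_linear_Pair bounded_linear_ident bounded_linear_zero open_Times ci T simp: z(2))
  from smooth_on_bilinear[OF bounded_bilinear_cscale T smooth_on_const[OF T] this, of "1 / ?m"]
  have "smooth_on T (\<lambda>\<tau>. Higgs (X \<tau>) c ?z x)"
    by (rule smooth_on_cong[OF T, THEN iffD1, rotated]) (simp add: g(2) vec_eq_iff m)
  from smooth_on_differentiable[OF this t]
  show "((\<lambda>\<tau>. Higgs (X \<tau>) c ?z x) has_vector_derivative 0) (at t)"
    using hamiltonian_trajectory_velocity_eq_0(1)[OF surface H flow t c p, of x]
    unfolding vector_derivative_works by (simp add: velocity_def)
  have "smooth_on T (\<lambda>\<tau>. g' ((0, ?z) + (\<tau>, 0)))"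
    by (rule smooth_on_compose_affine[OF _ _ T g'(1)])
      (auto intro!: bounded_linear_Pair bounded_linear_ident bounded_linear_zero open_Times ci T simp: z(2))
  from smooth_on_bilinear[OF bounded_bilinear_mult T smooth_on_const[OF T] this, of "1 / ?m"]
  have "smooth_on T (\<lambda>\<tau>. kay (X \<tau>) c ?z)"
    by (rule smooth_on_cong[OF T, THEN iffD1, rotated]) (simp add: g'(2) m)
  from smooth_on_differentiable[OF this t]
  show "((\<lambda>\<tau>. kay (X \<tau>) c ?z) has_vector_derivative 0) (at t)"
    using hamiltonian_trajectory_velocity_eq_0(2)[OF surface H flow t c p]
    unfolding vector_derivative_works by (simp add: velocity_def)
qed

section \<open>The Zakharov--Shabat equation\<close>

lemma smooth_on_partial_derivatives:
  fixes G :: "real \<times> real \<Rightarrow> 'b::real_normed_vector"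
  assumes "smooth_on S G" "(t, x) \<in> S"
  shows "((\<lambda>\<tau>. G (\<tau>, x)) has_vector_derivative frechet_derivative G (at (t, x)) (1, 0)) (at t)"
    and "((\<lambda>y. G (t, y)) has_vector_derivative frechet_derivative G (at (t, x)) (0, 1)) (at x)"
proof -
  note G = smooth_on_has_derivative[OF assms]
  interpret bounded_linear "frechet_derivative G (at (t, x))"
    using G by (rule has_derivative_bounded_linear)
  have "((\<lambda>\<tau>. (\<tau>, x)) has_derivative (\<lambda>h. (h, 0))) (at t)"
    and "((\<lambda>y. (t, y)) has_derivative (\<lambda>h. (0, h))) (at x)"
    by (auto intro!: derivative_eq_intros)
  from this[THEN has_derivative_compose] G
  have "((\<lambda>\<tau>. G (\<tau>, x)) has_derivative (\<lambda>h. frechet_derivative G (at (t, x)) (h, 0))) (at t)"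
    and "((\<lambda>y. G (t, y)) has_derivative (\<lambda>h. frechet_derivative G (at (t, x)) (0, h))) (at x)"
    by blast+
  moreover have e: "(\<lambda>h. frechet_derivative G (at (t, x)) (h, 0)) =
        (\<lambda>h. h *\<^sub>R frechet_derivative G (at (t, x)) (1, 0))"
      "(\<lambda>h. frechet_derivative G (at (t, x)) (0, h)) =
        (\<lambda>h. h *\<^sub>R frechet_derivative G (at (t, x)) (0, 1))"
  proof -
    show "(\<lambda>h. frechet_derivative G (at (t, x)) (h, 0)) =
        (\<lambda>h. h *\<^sub>R frechet_derivative G (at (t, x)) (1, 0))"
      by (rule ext) (simp flip: scale)
    show "(\<lambda>h. frechet_derivative G (at (t, x)) (0, h)) =
        (\<lambda>h. h *\<^sub>R frechet_derivative G (at (t, x)) (0, 1))"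
      by (rule ext) (simp flip: scale)
  qed
  ultimately show "((\<lambda>\<tau>. G (\<tau>, x)) has_vector_derivative frechet_derivative G (at (t, x)) (1, 0)) (at t)"
    and "((\<lambda>y. G (t, y)) has_vector_derivative frechet_derivative G (at (t, x)) (0, 1)) (at x)"
    unfolding has_vector_derivative_def e by blast+
qed

text \<open>\<open>G\<close> is its value at an endpoint plus the integral of \<open>Gx\<close>.
  Differentiating in time under the integral, and then in the upper limit, leaves the time
  derivative of \<open>Gx\<close>, since the endpoint term does not depend on the upper
  limit.\<close>

lemma mixed_partials_eq:
  fixes G :: "real \<times> real \<Rightarrow> 'b::banach"
  assumes "open S" "smooth_on S G" "(t, x) \<in> S"
  defines "Gt \<equiv> \<lambda>y. frechet_derivative G (at y) (1, 0)"
    and "Gx \<equiv> \<lambda>y. frechet_derivative G (at y) (0, 1)"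
  shows "frechet_derivative Gt (at (t, x)) (0, 1) = frechet_derivative Gx (at (t, x)) (1, 0)"
proof -
  obtain A B where AB: "open A" "open B" "t \<in> A" "x \<in> B" "A \<times> B \<subseteq> S"
    using open_prod_elim[OF assms(1,3)] by (metis mem_Sigma_iff)
  \<comment> \<open>Closed intervals are taken so that \<open>Gx\<close> and \<open>Gxt\<close> are
    continuous on a compact rectangle, as differentiation under the integral asks.\<close>
  obtain r where r: "0 < r" "cball t r \<subseteq> A" using AB open_contains_cball by blast
  obtain e where e: "0 < e" "cball x e \<subseteq> B" using AB open_contains_cball by blast
  let ?U = "{t - r..t + r}" and ?a = "x - e" and ?b = "x + e"
  have sub: "(\<tau>, y) \<in> S" if "\<tau> \<in> ?U" "y \<in> {?a..?b}" for \<tau> y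
    using that r e by (intro subsetD[OF AB(5)]) (auto simp: cball_eq_atLeastAtMost)
  have sGt: "smooth_on S Gt" and sGx: "smooth_on S Gx"
    unfolding Gt_def Gx_def by (intro smooth_on_frechet assms)+
  define Gxt where "Gxt = (\<lambda>y. frechet_derivative Gx (at y) (1, 0))"
  have sGxt: "smooth_on S Gxt" unfolding Gxt_def by (intro smooth_on_frechet sGx)
  have slice: "continuous_on {?a..y} (\<lambda>s. K (\<tau>, s))"
    if "smooth_on S K" "\<tau> \<in> ?U" "y \<le> ?b" for K :: "real \<times> real \<Rightarrow> 'b" and \<tau> y
    by (rule continuous_on_compose2[OF smooth_on_continuous[OF that(1)]])
      (use sub that in \<open>auto intro!: continuous_intros\<close>)
  have ftc: "G (\<tau>, y) = G (\<tau>, ?a) + integral {?a..y} (\<lambda>s. Gx (\<tau>, s))"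
    if "\<tau> \<in> ?U" "y \<in> {?a..?b}" for \<tau> y
  proof -
    have "((\<lambda>s. Gx (\<tau>, s)) has_integral G (\<tau>, y) - G (\<tau>, ?a)) {?a..y}"
      unfolding Gx_def
      by (rule fundamental_theorem_of_calculus[OF _ has_vector_derivative_at_within[
            OF smooth_on_partial_derivatives(2)[OF assms(2)]]]) (use that sub in auto)
    then show ?thesis by (simp add: integral_unique)
  qed
  have t: "t \<in> ?U" "t \<in> interior ?U" using r by auto
  have Gt: "Gt (t, y) = Gt (t, ?a) + integral {?a..y} (\<lambda>s. Gxt (t, s))" if y: "y \<in> {?a..?b}" for y
  proof -
    have "((\<lambda>\<tau>. integral (cbox ?a y) (\<lambda>s. Gx (\<tau>, s))) has_vector_derivative
        integral (cbox ?a y) (\<lambda>s. Gxt (t, s))) (at t within ?U)"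
    proof (rule leibniz_rule_vector_derivative)
      show "((\<lambda>\<tau>. Gx (\<tau>, s)) has_vector_derivative Gxt (\<tau>, s)) (at \<tau> within ?U)"
        if "\<tau> \<in> ?U" "s \<in> cbox ?a y" for \<tau> s
        unfolding Gxt_def
        by (rule has_vector_derivative_at_within[OF smooth_on_partial_derivatives(1)[OF sGx sub]])
          (use that y in auto)
      show "(\<lambda>s. Gx (\<tau>, s)) integrable_on cbox ?a y" if "\<tau> \<in> ?U" for \<tau>
        using integrable_continuous_real[OF slice[OF sGx that]] y by simp
      show "continuous_on (?U \<times> cbox ?a y) (\<lambda>(\<tau>, s). Gxt (\<tau>, s))"
        by (simp add: case_prod_unfold)
          (rule continuous_on_subset[OF smooth_on_continuous[OF sGxt]]; use sub y in auto)
    qed (use t in auto)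
    then have "((\<lambda>\<tau>. integral {?a..y} (\<lambda>s. Gx (\<tau>, s))) has_vector_derivative
        integral {?a..y} (\<lambda>s. Gxt (t, s))) (at t)"
      using at_within_interior[OF t(2)] by simp
    moreover have "((\<lambda>\<tau>. G (\<tau>, ?a)) has_vector_derivative Gt (t, ?a)) (at t)"
      unfolding Gt_def using smooth_on_partial_derivatives(1)[OF assms(2) sub[OF t(1)]] e by simp
    ultimately have "((\<lambda>\<tau>. G (\<tau>, ?a) + integral {?a..y} (\<lambda>s. Gx (\<tau>, s))) has_vector_derivative
        Gt (t, ?a) + integral {?a..y} (\<lambda>s. Gxt (t, s))) (at t)"
      by (intro has_vector_derivative_add)
    then have "((\<lambda>\<tau>. G (\<tau>, y)) has_vector_derivative
        Gt (t, ?a) + integral {?a..y} (\<lambda>s. Gxt (t, s))) (at t)"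
      by (rule has_vector_derivative_transform_within_open[OF _ open_interior t(2)])
        (use ftc[OF _ y] interior_subset[of ?U] in auto)
    moreover have "((\<lambda>\<tau>. G (\<tau>, y)) has_vector_derivative Gt (t, y)) (at t)"
      unfolding Gt_def using smooth_on_partial_derivatives(1)[OF assms(2) sub[OF t(1) y]] by simp
    ultimately show ?thesis by (rule vector_derivative_unique_at[symmetric])
  qed
  have x: "x \<in> {?a..?b}" "x \<in> interior {?a..?b}" using e by auto
  have "((\<lambda>y. integral {?a..y} (\<lambda>s. Gxt (t, s))) has_vector_derivative Gxt (t, x)) (at x within {?a..?b})"
    by (rule integral_has_vector_derivative[OF slice[OF sGxt t(1)] x(1)]) simp
  then have "((\<lambda>y. Gt (t, ?a) + integral {?a..y} (\<lambda>s. Gxt (t, s))) has_vector_derivative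
      0 + Gxt (t, x)) (at x)"
    using at_within_interior[OF x(2)] by (intro has_vector_derivative_add has_vector_derivative_const) simp
  then have "((\<lambda>y. Gt (t, y)) has_vector_derivative 0 + Gxt (t, x)) (at x)"
    by (rule has_vector_derivative_transform_within_open[OF _ open_interior x(2)])
      (rule Gt[symmetric], use interior_subset in blast)
  then have "frechet_derivative Gt (at (t, x)) (0, 1) = 0 + Gxt (t, x)"
    by (rule vector_derivative_unique_at[OF smooth_on_partial_derivatives(2)[OF sGt assms(3)]])
  then show ?thesis by (simp add: Gxt_def)
qed

section \<open>The derivative of the matrix inverse\<close>

lemma matrix_inv_inverse:
  assumes "invertible A"
  shows "A ** matrix_inv A = mat 1" "matrix_inv A ** A = mat 1"
  using someI_ex[OF assms[unfolded invertible_def]] by (simp_all add: matrix_inv_def)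

text \<open>Cramer's rule for the columns of the inverse: the chosen \<open>matrix_inv\<close>
  becomes a quotient of determinants, whose differentiability is visible.\<close>

lemma matrix_inv_nth:
  fixes A :: "complex^'n::finite^'n"
  assumes "invertible A"
  shows "matrix_inv A $ k $ l = det (\<chi> i j. if j = k then mat 1 $ i $ l else A $ i $ j) / det A"
proof -
  have "A *v (\<chi> k. matrix_inv A $ k $ l) = (\<chi> i. (A ** matrix_inv A) $ i $ l)"
    by (simp add: vec_eq_iff matrix_vector_mult_def matrix_matrix_mult_def)
  then have "A *v (\<chi> k. matrix_inv A $ k $ l) = (\<chi> i. mat 1 $ i $ l)"
    by (simp add: matrix_inv_inverse[OF assms])
  then have "(\<chi> k. matrix_inv A $ k $ l) =
      (\<chi> k. det (\<chi> i j. if j = k then (\<chi> i. mat 1 $ i $ l) $ i else A $ i $ j) / det A)"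
    using cramer assms invertible_det_nz by blast
  then show ?thesis by (simp add: vec_eq_iff cong: if_cong)
qed

lemma differentiable_det:
  fixes F :: "real \<Rightarrow> complex^'n::finite^'n"
  assumes "\<And>i j. (\<lambda>\<tau>. F \<tau> $ i $ j) differentiable (at t)"
  shows "(\<lambda>\<tau>. det (F \<tau>)) differentiable (at t)"
proof -
  have "(\<lambda>\<tau>. \<Prod>i\<in>UNIV. F \<tau> $ i $ p i) differentiable (at t)" for p
    by (rule differentiableI[OF has_derivative_prod[OF assms[unfolded frechet_derivative_works]]])
  then show ?thesis
    unfolding det_def
    by (intro differentiable_sum differentiable_mult differentiable_const finite_permutations ballI) auto
qed

lemma differentiable_vecI:
  fixes F :: "'a::real_normed_vector \<Rightarrow> 'b::euclidean_space^'n"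
  assumes "\<And>i. (\<lambda>x. F x $ i) differentiable (at a)"
  shows "F differentiable (at a)"
  using assms[unfolded differentiable_componentwise_within[of "\<lambda>x. F x $ _"]]
  by (auto simp: differentiable_componentwise_within[of F] Basis_vec_def inner_axis)

text \<open>The product rule for the inverse times \<open>F\<close> gives the formula once the
  inverse is known to be differentiable. That comes from Cramer's quotients, whose denominators are
  nonzero near \<open>t\<close>.\<close>

lemma has_vector_derivative_matrix_inv:
  fixes F :: "real \<Rightarrow> complex^'n::finite^'n"
  assumes F: "(F has_vector_derivative F') (at t)"
    and U: "open U" "t \<in> U" "\<And>\<tau>. \<tau> \<in> U \<Longrightarrow> invertible (F \<tau>)"
  shows "((\<lambda>\<tau>. matrix_inv (F \<tau>)) has_vector_derivative
    - (matrix_inv (F t) ** F' ** matrix_inv (F t))) (at t)"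
proof -
  interpret mult: bounded_bilinear "(**) :: complex^'n^'n \<Rightarrow> complex^'n^'n \<Rightarrow> complex^'n^'n"
    by (rule bounded_bilinear_matrix_mult)
  have "(\<lambda>\<tau>. F \<tau> $ i $ j) differentiable (at t)" for i j
    using bounded_linear.has_vector_derivative[OF bounded_linear_compose[OF bounded_linear_vec_nth
          bounded_linear_vec_nth] F] by (blast intro: differentiableI_vector)
  \<comment> \<open>This treats together the replaced column, which is constant in \<tau>, and the
    remaining entries.\<close>
  then have "(\<lambda>\<tau>. if b then c else F \<tau> $ i $ j) differentiable (at t)" for b c i j
    by (cases b) auto
  then have "(\<lambda>\<tau>. det (\<chi> i j. if j = k then mat 1 $ i $ l else F \<tau> $ i $ j) / det (F \<tau>)) differentiable (at t)"
    for k l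
    using U(3)[OF U(2)] \<open>\<And>i j. (\<lambda>\<tau>. F \<tau> $ i $ j) differentiable (at t)\<close>
    by (intro differentiable_divide differentiable_det) (auto simp: invertible_det_nz)
  then have inv: "\<And>k l. (\<lambda>\<tau>. matrix_inv (F \<tau>) $ k $ l) differentiable (at t)"
  proof -
    fix k l
    obtain D where "((\<lambda>\<tau>. det (\<chi> i j. if j = k then mat 1 $ i $ l else F \<tau> $ i $ j) / det (F \<tau>))
        has_derivative D) (at t)"
      using \<open>\<And>k l. (\<lambda>\<tau>. det (\<chi> i j. if j = k then mat 1 $ i $ l else F \<tau> $ i $ j) / det (F \<tau>))
        differentiable (at t)\<close> unfolding differentiable_def by blast
    then have "((\<lambda>\<tau>. matrix_inv (F \<tau>) $ k $ l) has_derivative D) (at t)"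
      by (rule has_derivative_transform_within_open[OF _ U(1,2)]) (simp add: matrix_inv_nth U(3))
    then show "(\<lambda>\<tau>. matrix_inv (F \<tau>) $ k $ l) differentiable (at t)" by (rule differentiableI)
  qed
  then have "(\<lambda>\<tau>. matrix_inv (F \<tau>)) differentiable (at t)"
    using inv by (intro differentiable_vecI)
  then obtain D where D: "((\<lambda>\<tau>. matrix_inv (F \<tau>)) has_vector_derivative D) (at t)"
    using vector_derivative_works by blast
  have "((\<lambda>\<tau>. matrix_inv (F \<tau>) ** F \<tau>) has_vector_derivative matrix_inv (F t) ** F' + D ** F t) (at t)"
    by (rule mult.has_vector_derivative[OF D F])
  moreover have "((\<lambda>\<tau>. matrix_inv (F \<tau>) ** F \<tau>) has_vector_derivative 0) (at t)"
    by (rule has_vector_derivative_transform_within_open[OF has_vector_derivative_const U(1,2)])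
      (simp add: U matrix_inv_inverse)
  ultimately have "matrix_inv (F t) ** F' + D ** F t = 0"
    by (rule vector_derivative_unique_at)
  then have "D ** F t ** matrix_inv (F t) = - (matrix_inv (F t) ** F') ** matrix_inv (F t)"
    by (simp add: add_eq_0_iff)
  then have "D = - (matrix_inv (F t) ** F' ** matrix_inv (F t))"
    using U by (simp add: matrix_inv_inverse mult.minus_left flip: matrix_mul_assoc)
  then show ?thesis using D by simp
qed

theorem mainTheorem6:
  fixes \<A> :: "'p::t2_space chart set"
    and n :: nat and pts :: "nat \<Rightarrow> 'p"
    and \<O> :: "nat \<Rightarrow> 'n::finite loop_dual set"
    and c0 :: "'p chart" and p0 :: 'p and \<rho> :: real and D :: "complex set"
    and j :: int and coef_j :: "(complex \<Rightarrow> complex) \<Rightarrow> complex"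
    and T :: "real set" and X :: "real \<Rightarrow> ('p, 'n) hitchin_fields"
    and f :: "real \<Rightarrow> 'p \<Rightarrow> real \<Rightarrow> complex^'n^'n"
    and gauge_slice :: "('p, 'n) loop_form set"
    and Lbar L :: "real \<Rightarrow> ('p, 'n) loop_form"
    and M_j :: "real \<Rightarrow> 'p \<Rightarrow> real \<Rightarrow> complex^'n^'n"
  assumes surface: "riemann_surface \<A>"
    and marked: "inj_on pts {..<n}"
    and orbits: "\<forall>\<alpha><n. is_coadjoint_orbit (\<O> \<alpha>)"
    and coordinate: "c0 \<in> \<A>" "p0 \<in> fst c0"
    and disc: "0 < \<rho>" "ball (snd c0 p0) \<rho> \<subseteq> chart_image c0"
      "D = ball (snd c0 p0) \<rho> \<or> D = ball (snd c0 p0) \<rho> - {snd c0 p0}"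
      "D \<subseteq> regular_image n pts c0"
    and coefficient: "coefficient_functional (snd c0 p0) \<rho> D j coef_j"
    and time: "open T" "is_interval T"
    and flow: "hamiltonian_trajectory \<A> n pts \<O> (hitchin_hamiltonian c0 coef_j) T X"
    and k_nonzero: "\<forall>t\<in>T. \<forall>z\<in>D. kay (X t) c0 z \<noteq> 0"
    and constraint: "\<forall>t\<in>T. X t \<in> zero_momentum \<A> n pts"
    and gauge: "gauge_family \<A> T f"
    and Lbar: "\<forall>t\<in>T. Lbar t = gauge_Abar (f t) (Abar (X t))"
    and gauge_fixed: "\<forall>t\<in>T. Lbar t \<in> gauge_slice"
    and L: "\<forall>t\<in>T. L t = gauge_Higgs (f t) (kay (X t)) (Higgs (X t))"
    and M: "\<forall>t\<in>T. \<forall>p x. M_j t p x =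
      matrix_inv (f t p x) ** vector_derivative (\<lambda>\<tau>. f \<tau> p x) (at t)"
  shows "\<forall>t\<in>T. \<forall>c\<in>\<A>. \<forall>p\<in>fst c - marks n pts. \<forall>x.
    (\<lambda>\<tau>. L \<tau> c (snd c p) x) differentiable (at t) \<and>
    M_j t p differentiable (at x) \<and>
    vector_derivative (\<lambda>\<tau>. L \<tau> c (snd c p) x) (at t)
      - cscale (kay (X t) c (snd c p)) (vector_derivative (M_j t p) (at x))
      + comm (M_j t p x) (L t c (snd c p) x) = 0"
proof (intro ballI allI)
  fix t c p x
  assume t: "t \<in> T" and c: "c \<in> \<A>" and p: "p \<in> fst c - marks n pts"
  let ?z = "snd c p"
  have cp: "chart_point c ?z = p" using chart_point_inverse[OF surface c] p by simp
  have H: "hitchin_hamiltonian c0 coef_j Y = hitchin_hamiltonian c0 coef_j Z"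
    if "Higgs Y = Higgs Z" "kay Y = kay Z" for Y Z :: "('p, 'n) hitchin_fields"
    using that by (simp add: hitchin_hamiltonian_def monodromy_trace_def[abs_def])
  note static = hamiltonian_trajectory_has_vector_derivative_0[OF surface time(1) H flow t c p]
  \<comment> \<open>The point \<open>p\<close> is frozen, so that time and x are the only variables
    left.\<close>
  define G where "G = (\<lambda>(\<tau>, y). f \<tau> p y)"
  let ?S = "T \<times> (UNIV :: real set)"
  have S: "open ?S" by (intro open_Times time open_UNIV)
  have G: "smooth_on ?S G"
  proof -
    have "smooth_on (T \<times> chart_image c \<times> UNIV) (\<lambda>(t, z, x). f t (chart_point c z) x)"
      using gauge c by (simp add: gauge_family_def)
    moreover have "open (T \<times> chart_image c \<times> (UNIV :: real set))"
      by (intro open_Times time open_UNIV chart_image_open[OF surface c])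
    ultimately have "smooth_on ?S (\<lambda>y. case (0, ?z, 0) + (fst y, 0, snd y) of
        (t, z, x) \<Rightarrow> f t (chart_point c z) x)"
      by (intro smooth_on_compose_affine[OF _ _ S])
        (use p in \<open>auto intro!: bounded_linear_intros bounded_linear_Pair bounded_linear_fst bounded_linear_snd\<close>)
    then show ?thesis by (simp add: G_def case_prod_unfold cp)
  qed
  define Gt where "Gt = (\<lambda>y. frechet_derivative G (at y) (1, 0))"
  define Gx where "Gx = (\<lambda>y. frechet_derivative G (at y) (0, 1))"
  have sGt: "smooth_on ?S Gt" and sGx: "smooth_on ?S Gx"
    unfolding Gt_def Gx_def by (intro smooth_on_frechet G)+
  have ft: "((\<lambda>\<tau>. f \<tau> p y) has_vector_derivative Gt (\<tau>, y)) (at \<tau>)"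
    and fx: "(f \<tau> p has_vector_derivative Gx (\<tau>, y)) (at y)" if "\<tau> \<in> T" for \<tau> y
    using smooth_on_partial_derivatives[OF G, of \<tau> y] that by (simp_all add: G_def Gt_def Gx_def)
  \<comment> \<open>The mixed derivative of \<open>f\<close>: it enters the time derivative of
    \<open>L\<close> through \<open>Gx\<close> and the x-derivative of \<open>M_j\<close> through
    \<open>Gt\<close>.\<close>
  define N where "N = frechet_derivative Gx (at (t, x)) (1, 0)"
  have N: "((\<lambda>\<tau>. Gx (\<tau>, x)) has_vector_derivative N) (at t)"
    "((\<lambda>y. Gt (t, y)) has_vector_derivative N) (at x)"
    using smooth_on_partial_derivatives(1)[OF sGx, of t x] smooth_on_partial_derivatives(2)[OF sGt, of t x]
      mixed_partials_eq[OF S G, of t x] t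
    by (simp_all add: N_def Gt_def Gx_def)
  have inv: "invertible (f \<tau> p y)" if "\<tau> \<in> T" for \<tau> y
    using gauge that by (simp add: gauge_family_def)
  define F where "F = f t p x"
  define B where "B = matrix_inv F"
  define k where "k = kay (X t) c ?z"
  define \<Phi> where "\<Phi> = Higgs (X t) c ?z x"
  let ?ft = "Gt (t, x)" and ?fx = "Gx (t, x)"
  interpret mult: bounded_bilinear "(**) :: complex^'n^'n \<Rightarrow> complex^'n^'n \<Rightarrow> complex^'n^'n"
    by (rule bounded_bilinear_matrix_mult)
  interpret cs: bounded_bilinear "cscale :: complex \<Rightarrow> complex^'n^'n \<Rightarrow> complex^'n^'n"
    by (rule bounded_bilinear_cscale)
  have Bt: "((\<lambda>\<tau>. matrix_inv (f \<tau> p x)) has_vector_derivative - (B ** ?ft ** B)) (at t)"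
    unfolding B_def F_def by (rule has_vector_derivative_matrix_inv[OF ft[OF t] time(1) t inv])
  have Bx: "((\<lambda>y. matrix_inv (f t p y)) has_vector_derivative - (B ** ?fx ** B)) (at x)"
    unfolding B_def F_def by (rule has_vector_derivative_matrix_inv[OF fx[OF t] open_UNIV UNIV_I inv[OF t]])
  have L_eq: "L \<tau> c ?z x = cscale (kay (X \<tau>) c ?z) (matrix_inv (f \<tau> p x) ** Gx (\<tau>, x))
      + matrix_inv (f \<tau> p x) ** Higgs (X \<tau>) c ?z x ** f \<tau> p x" if "\<tau> \<in> T" for \<tau>
    using L that by (simp add: gauge_Higgs_def cp dx_def vector_derivative_at[OF fx[OF that]])
  \<comment> \<open>The product rule before simplification: \<open>cscale 0\<close> and
    \<open>B ** 0\<close> are the places of the vanishing time derivatives of \<open>k\<close> and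
    of the Higgs field.\<close>
  let ?L' = "(cscale k (B ** N + - (B ** ?ft ** B) ** ?fx) + cscale 0 (B ** ?fx)) +
      ((B ** \<Phi>) ** ?ft + (B ** 0 + - (B ** ?ft ** B) ** \<Phi>) ** F)"
  have "((\<lambda>\<tau>. cscale (kay (X \<tau>) c ?z) (matrix_inv (f \<tau> p x) ** Gx (\<tau>, x))
      + matrix_inv (f \<tau> p x) ** Higgs (X \<tau>) c ?z x ** f \<tau> p x) has_vector_derivative ?L') (at t)"
    unfolding k_def B_def F_def \<Phi>_def
    by (intro has_vector_derivative_add cs.has_vector_derivative mult.has_vector_derivative static
        Bt[unfolded B_def F_def] ft[OF t] N)
  \<comment> \<open>\<open>L\<close> is prescribed on \<open>T\<close> only, which determines its
    derivative because \<open>T\<close> is open.\<close>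
  then have L': "((\<lambda>\<tau>. L \<tau> c ?z x) has_vector_derivative ?L') (at t)"
    by (rule has_vector_derivative_transform_within_open[OF _ time(1) t]) (simp add: L_eq)
  have M_eq: "M_j t p = (\<lambda>y. matrix_inv (f t p y) ** Gt (t, y))"
    using M t by (simp add: fun_eq_iff vector_derivative_at[OF ft[OF t]])
  have M': "(M_j t p has_vector_derivative B ** N + - (B ** ?fx ** B) ** ?ft) (at x)"
    unfolding M_eq B_def F_def
    by (intro mult.has_vector_derivative Bx[unfolded B_def F_def] N)
  have FB: "F ** B = mat 1" "B ** F = mat 1"
    unfolding B_def F_def using matrix_inv_inverse[OF inv[OF t]] by blast+
  \<comment> \<open>Products are normalized to left nesting, so \<open>F ** B\<close> has to be
    cancelled behind an arbitrary factor.\<close>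
  have FB': "A ** F ** B = A" for A :: "complex^'n^'n"
    using FB by (simp flip: matrix_mul_assoc)
  have Lt: "L t c ?z x = cscale k (B ** ?fx) + B ** \<Phi> ** F"
    using L_eq[OF t] by (simp add: k_def B_def F_def \<Phi>_def)
  have Mt: "M_j t p x = B ** ?ft" by (simp add: M_eq B_def F_def)
  \<comment> \<open>The terms with \<open>N\<close> cancel. With M = \<open>B ** ?ft\<close> and P =
    \<open>B ** ?fx\<close>, the derivatives of the inverse leave -k [M, P], which the commutator
    cancels; in the Higgs part \<open>F ** B = mat 1\<close> removes the rest.\<close>
  have "?L' - cscale k (B ** N + - (B ** ?fx ** B) ** ?ft)
      + comm (B ** ?ft) (cscale k (B ** ?fx) + B ** \<Phi> ** F) = 0"
    by (simp add: comm_def mult.add_left mult.add_right mult.minus_left mult.minus_right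
        mult.zero_left mult.zero_right cs.add_right cs.diff_right cs.minus_right cs.zero_left
        cscale_matrix_mult_left cscale_matrix_mult_right matrix_mul_assoc FB' FB)
  then show "(\<lambda>\<tau>. L \<tau> c ?z x) differentiable (at t) \<and>
    M_j t p differentiable (at x) \<and>
    vector_derivative (\<lambda>\<tau>. L \<tau> c ?z x) (at t)
      - cscale (kay (X t) c ?z) (vector_derivative (M_j t p) (at x))
      + comm (M_j t p x) (L t c ?z x) = 0"
    unfolding vector_derivative_at[OF L'] vector_derivative_at[OF M'] Lt Mt k_def[symmetric]
    using L' M' by (blast intro: differentiableI_vector)
qed

end
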